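(* Let $(\mathsf{X}_1,\mathcal{A}_1,\varphi_1)$ and $(\mathsf{X}_2,\mathcal{A}_2,\varphi_2)$ be probability spaces, and let $\varphi$ be a probability measure on $\mathcal{A}_1\times\mathcal{A}_2$ with disintegrations $$\varphi(\mathrm{d}(x_1,x_2))=\varphi_1(\mathrm{d}x_1)\,\varphi_{2,x_1}(\mathrm{d}x_2)=\varphi_2(\mathrm{d}x_2)\,\varphi_{1,x_2}(\mathrm{d}x_1).$$ For $i\in\{1,2\}$ (with $x_{-1}=x_2$, $x_{-2}=x_1$), let $H_{i,x_{-i}}:\mathsf{X}_i\times\mathcal{A}_i\to[0,1]$ be a Markov transition kernel reversible with respect to $\varphi_{i,x_{-i}}$, with $(x_1,x_2)\mapsto H_{i,x_{-i}}(x_i,\mathsf{A})$ measurable for every $\mathsf{A}\in\mathcal{A}_i$. Define on $\mathsf{X}_1\times\mathsf{X}_2$ the kernel $$T((x_1,x_2),\mathrm{d}(x_1',x_2'))=H_{1,x_2}(x_1,\mathrm{d}x_1')\,H_{2,x_1'}(x_2,\mathrm{d}x_2'),$$ which satisfies $\varphi T=\varphi$, and on $\mathsf{X}_2$ the kernels $$\hat S_1(x_2,\mathrm{d}x_2')=\int_{\mathsf{X}_1}\varphi_{1,x_2}(\mathrm{d}x_1)\,H_{2,x_1}(x_2,\mathrm{d}x_2'),\qquad \hat S_2(x_2,\mathrm{d}x_2')=\int_{\mathsf{X}_1}\varphi_{1,x_2}(\mathrm{d}x_1)\,H_{2,x_1}^2(x_2,\mathrm{d}x_2'),$$ which are reversible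 with respect to $\varphi_2$. Then $$1-\|T\|_\varphi^2\ \ge\ \Big(1-\operatorname*{ess\,sup}_{x_2}\|H_{1,x_2}\|_{\varphi_{1,x_2}}^2\Big)\,\mathrm{Gap}(\hat S_2),$$ where the essential supremum is taken with respect to $\varphi_2$. If, furthermore, $H_{2,x_1}$ is positive semi-definite for $\varphi_1$-a.e. $x_1\in\mathsf{X}_1$, then $\mathrm{Gap}(\hat S_2)\ge\mathrm{Gap}(\hat S_1)$.
   Context: For a probability measure $\rho$, $L_0^2(\rho)$ is the Hilbert space of real square-integrable functions with $\rho$-mean zero, with inner product $\langle f,g\rangle_\rho=\int fg\,\mathrm{d}\rho$ and norm $\|\cdot\|_\rho$. A Markov transition kernel $K$ with $\rho K=\rho$ acts on $L_0^2(\rho)$ by $Kf(w)=\int K(w,\mathrm{d}w')f(w')$, and $\|K\|_\rho$ denotes the operator norm on $L_0^2(\rho)$. $K$ is reversible with respect to $\rho$ iff this operator is self-adjoint; positive semi-definite means self-adjoint with $\langle f,Kf\rangle_\rho\ge0$ for all $f\in L_0^2(\rho)$. $K^2$ denotes the two-step kernel $K^2(w,\mathsf{F})=\int K(w,\mathrm{d}w')K(w',\mathsf{F})$. For self-adjoint $J$ on $L_0^2(\rho)$ with norm at most $1$, $\mathrm{Gap}(J)=\inf_{f\in L_0^2(\rho)\setminus\{0\}}(\|f\|_\rho^2-\langle f,Jf\rangle_\rho)/\|f\|_\rho^2$ (this presumes $L_0^2(\rho)\neq\{0\}$). *)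

theory Defs
  imports "HOL-Probability.Probability"
begin

text \<open>
  Elements of the Hilbert space \<open>L\<^sub>0\<^sup>2(\<rho>)\<close> are represented by square-integrable
  functions; two representatives give the same element iff they agree \<open>\<rho>\<close>-a.e., so
  \<open>f \<noteq> 0\<close> in the Hilbert space reads \<open>l2_norm \<rho> f \<noteq> 0\<close>.
\<close>

definition L2_0 :: "'a measure \<Rightarrow> ('a \<Rightarrow> real) set" where
  "L2_0 \<rho> = {f \<in> borel_measurable \<rho>. integrable \<rho> (\<lambda>x. (f x)\<^sup>2) \<and> (\<integral>x. f x \<partial>\<rho>) = 0}"

definition l2_inner :: "'a measure \<Rightarrow> ('a \<Rightarrow> real) \<Rightarrow> ('a \<Rightarrow> real) \<Rightarrow> real" where
  "l2_inner \<rho> f g = (\<integral>x. f x * g x \<partial>\<rho>)"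

definition l2_norm :: "'a measure \<Rightarrow> ('a \<Rightarrow> real) \<Rightarrow> real" where
  "l2_norm \<rho> f = sqrt (l2_inner \<rho> f f)"

text \<open>
  If \<open>\<rho>\<close> is invariant under \<open>K\<close> and \<open>f\<close> is square-integrable, then \<open>f\<close> is \<open>K w\<close>-integrable
  for \<open>\<rho>\<close>-a.e. \<open>w\<close>; at the remaining \<open>w\<close> the integral below is \<open>0\<close> by convention.
\<close>

definition kernel_op :: "('a \<Rightarrow> 'a measure) \<Rightarrow> ('a \<Rightarrow> real) \<Rightarrow> 'a \<Rightarrow> real" where
  "kernel_op K f = (\<lambda>w. \<integral>w'. f w' \<partial>K w)"

text \<open>
  The supremum is over the closed unit ball rather than over quotients of norms, so that it
  also makes sense (with value \<open>0\<close>) when \<open>L\<^sub>0\<^sup>2(\<rho>)\<close> is trivial.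
\<close>

definition op_norm :: "'a measure \<Rightarrow> (('a \<Rightarrow> real) \<Rightarrow> 'a \<Rightarrow> real) \<Rightarrow> real" where
  "op_norm \<rho> J = (SUP f\<in>{f \<in> L2_0 \<rho>. l2_norm \<rho> f \<le> 1}. l2_norm \<rho> (J f))"

definition self_adjoint :: "'a measure \<Rightarrow> (('a \<Rightarrow> real) \<Rightarrow> 'a \<Rightarrow> real) \<Rightarrow> bool" where
  "self_adjoint \<rho> J \<longleftrightarrow> (\<forall>f\<in>L2_0 \<rho>. \<forall>g\<in>L2_0 \<rho>. l2_inner \<rho> f (J g) = l2_inner \<rho> (J f) g)"

definition pos_semidef :: "'a measure \<Rightarrow> (('a \<Rightarrow> real) \<Rightarrow> 'a \<Rightarrow> real) \<Rightarrow> bool" where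
  "pos_semidef \<rho> J \<longleftrightarrow> self_adjoint \<rho> J \<and> (\<forall>f\<in>L2_0 \<rho>. l2_inner \<rho> f (J f) \<ge> 0)"

text \<open>Only meaningful when \<open>L\<^sub>0\<^sup>2(\<rho>)\<close> is nontrivial: otherwise the infimum is over the empty set.\<close>

definition Gap :: "'a measure \<Rightarrow> (('a \<Rightarrow> real) \<Rightarrow> 'a \<Rightarrow> real) \<Rightarrow> real" where
  "Gap \<rho> J = (INF f\<in>{f \<in> L2_0 \<rho>. l2_norm \<rho> f \<noteq> 0}.
     ((l2_norm \<rho> f)\<^sup>2 - l2_inner \<rho> f (J f)) / (l2_norm \<rho> f)\<^sup>2)"

definition invariant :: "'a measure \<Rightarrow> ('a \<Rightarrow> 'a measure) \<Rightarrow> bool" where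
  "invariant \<rho> K \<longleftrightarrow> \<rho> \<bind> K = \<rho>"

definition reversible :: "'a measure \<Rightarrow> ('a \<Rightarrow> 'a measure) \<Rightarrow> bool" where
  "reversible \<rho> K \<longleftrightarrow> invariant \<rho> K \<and> self_adjoint \<rho> (kernel_op K)"

definition two_step :: "('a \<Rightarrow> 'a measure) \<Rightarrow> 'a \<Rightarrow> 'a measure" where
  "two_step K = (\<lambda>w. K w \<bind> K)"

text \<open>
  The essential supremum as the least essential upper bound. The library's \<^const>\<open>esssup\<close> is
  not used because it is \<open>\<infinity>\<close> on non-measurable functions, and \<open>x\<^sub>2 \<mapsto> \<parallel>H\<^sub>1\<^sub>,\<^sub>x\<^sub>2\<parallel>\<close> need not be
  measurable on general measurable spaces.
\<close>

definition ess_sup :: "'a measure \<Rightarrow> ('a \<Rightarrow> real) \<Rightarrow> real" where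
  "ess_sup \<rho> g = Inf {c. AE x in \<rho>. g x \<le> c}"

text \<open>
  In the following, \<open>H1 x2\<close> is a kernel on the first space, indexed by the second coordinate,
  and \<open>H2 x1\<close> a kernel on the second space, indexed by the first coordinate.
\<close>

definition T_kernel :: "'a measure \<Rightarrow> 'b measure \<Rightarrow> ('b \<Rightarrow> 'a \<Rightarrow> 'a measure) \<Rightarrow>
    ('a \<Rightarrow> 'b \<Rightarrow> 'b measure) \<Rightarrow> 'a \<times> 'b \<Rightarrow> ('a \<times> 'b) measure" where
  "T_kernel M1 M2 H1 H2 = (\<lambda>(x1, x2).
     H1 x2 x1 \<bind> (\<lambda>x1'. H2 x1' x2 \<bind> (\<lambda>x2'. return (M1 \<Otimes>\<^sub>M M2) (x1', x2'))))"

definition S1_hat :: "('b \<Rightarrow> 'a measure) \<Rightarrow> ('a \<Rightarrow> 'b \<Rightarrow> 'b measure) \<Rightarrow> 'b \<Rightarrow> 'b measure" where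
  "S1_hat \<phi>1c H2 = (\<lambda>x2. \<phi>1c x2 \<bind> (\<lambda>x1. H2 x1 x2))"

definition S2_hat :: "('b \<Rightarrow> 'a measure) \<Rightarrow> ('a \<Rightarrow> 'b \<Rightarrow> 'b measure) \<Rightarrow> 'b \<Rightarrow> 'b measure" where
  "S2_hat \<phi>1c H2 = (\<lambda>x2. \<phi>1c x2 \<bind> (\<lambda>x1. two_step (H2 x1) x2))"

end

(*
  Resampling one coordinate acts on the whole space: K1 and K2 move the first, respectively second,
  coordinate and fix the other. Both are self-adjoint on L^2(phi), and T = K1 K2.

  Let P g (x2) be the phi_{1,x2}-mean of g(., x2), and let c be the essential supremum. Splitting each
  fibre function into its mean and a centred part gives |K1 g|^2 <= (1 - c) |P g|^2 + c |g|^2, which is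
  used with g = K2 f. For h = P K2 f, regarded also as a function h' of both coordinates,
  |h|^2 = <h', K2 f> = <K2 h', f> and |K2 h'|^2 = <h, S2 h> <= (1 - Gap S2) |h|^2, so Cauchy-Schwarz yields
  |h|^2 <= (1 - Gap S2) |f|^2 and hence |T f|^2 <= (1 - (1 - c) Gap S2) |f|^2.

  In the positive case, |K2 h'|^2 <= <h', K2 h'> fibrewise, i.e. <h, S2 h> <= <h, S1 h>.
*)

theory Submission
  imports Defs
begin

section \<open>Square-integrable functions\<close>

text \<open>The hypotheses on the fibre kernels concern mean-zero functions only, whereas the fibre
  functions of a mean-zero function on the product have arbitrary means. Symmetry, positivity and
  the norm bound are therefore extended to all of \<open>L2\<close>: an invariant kernel fixes
  constants and preserves the mean, so the constant and the centred part never interact. The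
  two-step kernel enters because Cauchy-Schwarz leaves the square norm of \<open>K2 h'\<close>;
  self-adjointness turns it into the form of \<open>K2 K2\<close>, which acts on each fibre as the
  two-step kernel of \<open>H2 x1\<close>. The form of \<open>S2\<close> is thus nonnegative, so its
  gap is at most \<open>1\<close>, which keeps the constants in the estimates nonnegative. The norm
  of \<open>H1 x2\<close> may be non-measurable in \<open>x2\<close>. It is never integrated; only a
  constant that bounds its square for almost every \<open>x2\<close> is used. Operator identities
  hold almost everywhere only, since the integral of a non-integrable function is \<open>0\<close>
  by default.\<close>

definition L2 :: "'a measure \<Rightarrow> ('a \<Rightarrow> real) set" where
  "L2 M = {f \<in> borel_measurable M. integrable M (\<lambda>x. (f x)\<^sup>2)}"

lemma L2_I: "f \<in> borel_measurable M \<Longrightarrow> integrable M (\<lambda>x. (f x)\<^sup>2) \<Longrightarrow> f \<in> L2 M"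
  by (simp add: L2_def)

lemma L2_measurable [measurable_dest]: "f \<in> L2 M \<Longrightarrow> f \<in> borel_measurable M"
  by (simp add: L2_def)

lemma L2_square: "f \<in> L2 M \<Longrightarrow> integrable M (\<lambda>x. (f x)\<^sup>2)"
  by (simp add: L2_def)

lemma L2_0_eq: "L2_0 M = {f \<in> L2 M. (\<integral>x. f x \<partial>M) = 0}"
  by (auto simp: L2_0_def L2_def)

lemma L2_mult:
  assumes "f \<in> L2 M" "g \<in> L2 M"
  shows "integrable M (\<lambda>x. f x * g x)"
proof (rule Bochner_Integration.integrable_bound)
  show "integrable M (\<lambda>x. (f x)\<^sup>2 + (g x)\<^sup>2)"
    using assms by (intro Bochner_Integration.integrable_add L2_square)
  show "(\<lambda>x. f x * g x) \<in> borel_measurable M"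
    using assms by measurable
  have "\<bar>a\<bar> * \<bar>b\<bar> \<le> a\<^sup>2 + b\<^sup>2" for a b :: real
  proof -
    have "0 \<le> \<bar>a\<bar> * \<bar>b\<bar>" by simp
    then show ?thesis
      using sum_squares_bound[of "\<bar>a\<bar>" "\<bar>b\<bar>"] unfolding power2_abs by linarith
  qed
  then show "AE x in M. norm (f x * g x) \<le> norm ((f x)\<^sup>2 + (g x)\<^sup>2)"
    by (auto simp: abs_mult)
qed

lemma L2_add:
  assumes "f \<in> L2 M" "g \<in> L2 M"
  shows "(\<lambda>x. f x + g x) \<in> L2 M"
proof (rule L2_I)
  show "(\<lambda>x. f x + g x) \<in> borel_measurable M"
    using assms by measurable
  have "integrable M (\<lambda>x. (f x)\<^sup>2 + (g x)\<^sup>2 + 2 * (f x * g x))"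
    using assms by (intro Bochner_Integration.integrable_add integrable_mult_right L2_square L2_mult)
  then show "integrable M (\<lambda>x. (f x + g x)\<^sup>2)"
    by (simp add: power2_sum mult.assoc)
qed

lemma L2_cmult:
  assumes "f \<in> L2 M"
  shows "(\<lambda>x. c * f x) \<in> L2 M"
  using assms by (auto simp: L2_def power_mult_distrib)

lemma L2_diff:
  assumes "f \<in> L2 M" "g \<in> L2 M"
  shows "(\<lambda>x. f x - g x) \<in> L2 M"
  using L2_add[OF assms(1) L2_cmult[OF assms(2), of "-1"]] by simp

lemma (in finite_measure) L2_const: "(\<lambda>_. c) \<in> L2 M"
  by (simp add: L2_def)

lemma (in finite_measure) L2_integrable: "f \<in> L2 M \<Longrightarrow> integrable M f"
  by (auto simp: L2_def intro: square_integrable_imp_integrable)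

text \<open>The quadratic form in \<open>s\<close> and \<open>t\<close> obtained by integrating
  \<open>(s * f x - t * g x)^2\<close> is nonnegative; it is kept homogeneous so that no division by
  an integral is needed.\<close>

lemma L2_cauchy_schwarz:
  assumes f: "f \<in> L2 M" and g: "g \<in> L2 M"
  shows "(\<integral>x. f x * g x \<partial>M)\<^sup>2 \<le> (\<integral>x. (f x)\<^sup>2 \<partial>M) * (\<integral>x. (g x)\<^sup>2 \<partial>M)"
proof -
  define a b c where "a = (\<integral>x. (f x)\<^sup>2 \<partial>M)" "b = (\<integral>x. f x * g x \<partial>M)" "c = (\<integral>x. (g x)\<^sup>2 \<partial>M)"
  have pos: "0 \<le> a" "0 \<le> c" by (simp_all add: a_b_c_def)
  have q: "0 \<le> s\<^sup>2 * a - 2 * s * t * b + t\<^sup>2 * c" for s t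
  proof -
    have "0 \<le> (\<integral>x. (s * f x - t * g x)\<^sup>2 \<partial>M)" by simp
    also have "\<dots> = (\<integral>x. s\<^sup>2 * (f x)\<^sup>2 - 2 * s * t * (f x * g x) + t\<^sup>2 * (g x)\<^sup>2 \<partial>M)"
      by (intro Bochner_Integration.integral_cong) (auto simp: power2_eq_square algebra_simps)
    also have "\<dots> = s\<^sup>2 * a - 2 * s * t * b + t\<^sup>2 * c"
      using f g by (simp add: a_b_c_def L2_square L2_mult)
    finally show ?thesis .
  qed
  show ?thesis
  proof (cases "c = 0")
    case False
    \<comment> \<open>The choice \<open>s = c\<close>, \<open>t = b\<close> is the minimiser of the
      form up to scaling.\<close>
    have "0 \<le> c * (a * c - b\<^sup>2)"
      using q[of c b] by (simp add: power2_eq_square algebra_simps)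
    then show ?thesis
      using False pos unfolding a_b_c_def[symmetric] by (simp add: zero_le_mult_iff)
  next
    case True
    have "b = 0"
    proof (rule ccontr)
      assume "b \<noteq> 0"
      \<comment> \<open>With \<open>c = 0\<close> and \<open>s = 1\<close> the form is
        \<open>a - 2 * t * b\<close>; this \<open>t\<close> makes it equal to
        \<open>-1\<close>.\<close>
      then show False
        using q[of 1 "(a + 1) / (2 * b)"] True pos by simp
    qed
    then show ?thesis
      using True by (simp add: a_b_c_def)
  qed
qed

lemma (in prob_space) L2_integral_square_le:
  assumes "f \<in> L2 M"
  shows "(\<integral>x. f x \<partial>M)\<^sup>2 \<le> (\<integral>x. (f x)\<^sup>2 \<partial>M)"
  using L2_cauchy_schwarz[OF assms L2_const[of 1]] by (simp add: prob_space)

lemma (in prob_space) L2_centred: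
  assumes f: "f \<in> L2 M"
  defines "a \<equiv> (\<integral>x. f x \<partial>M)"
  shows "(\<lambda>x. f x - a) \<in> L2_0 M"
    and "(\<integral>x. (f x - a)\<^sup>2 \<partial>M) = (\<integral>x. (f x)\<^sup>2 \<partial>M) - a\<^sup>2"
proof -
  note int = L2_integrable[OF f] L2_square[OF f]
  show "(\<lambda>x. f x - a) \<in> L2_0 M"
    using f int by (simp add: L2_0_eq L2_diff L2_const prob_space a_def)
  show "(\<integral>x. (f x - a)\<^sup>2 \<partial>M) = (\<integral>x. (f x)\<^sup>2 \<partial>M) - a\<^sup>2"
    using int by (simp add: power2_diff prob_space a_def[symmetric]) (simp add: power2_eq_square)
qed

section \<open>Markov kernels acting on square-integrable functions\<close>

context
  fixes M :: "'a measure" and N :: "'b measure" and K :: "'a \<Rightarrow> 'b measure"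
  assumes prob: "prob_space M" and K: "K \<in> M \<rightarrow>\<^sub>M prob_algebra N"
begin

interpretation prob_space M by (rule prob)

lemma kernel_sub: "K \<in> M \<rightarrow>\<^sub>M subprob_algebra N"
  using K by (rule measurable_prob_algebraD)

lemma kernel_sets: "x \<in> space M \<Longrightarrow> sets (K x) = sets N"
  using measurable_space[OF K] by (simp add: space_prob_algebra)

lemma kernel_space: "x \<in> space M \<Longrightarrow> space (K x) = space N"
  using kernel_sets by (rule sets_eq_imp_space_eq)

lemma kernel_prob: "x \<in> space M \<Longrightarrow> prob_space (K x)"
  using measurable_space[OF K] by (simp add: space_prob_algebra)

lemma kernel_bind_sets: "sets (M \<bind> K) = sets N"
  by (rule sets_bind[OF kernel_sets not_empty])

lemma kernel_bind_prob: "prob_space (M \<bind> K)"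
  using kernel_prob by (intro prob_space_bind[OF _ kernel_sub] AE_I2)

lemma kernel_measurable_integral:
  fixes f :: "'b \<Rightarrow> real"
  assumes "f \<in> borel_measurable N"
  shows "(\<lambda>x. \<integral>y. f y \<partial>K x) \<in> borel_measurable M"
  by (rule measurable_compose[OF kernel_sub integral_measurable_subprob_algebra[OF assms]])

lemma kernel_measurable_nn_integral:
  assumes "f \<in> borel_measurable N"
  shows "(\<lambda>x. \<integral>\<^sup>+y. f y \<partial>K x) \<in> borel_measurable M"
  by (rule measurable_compose[OF kernel_sub nn_integral_measurable_subprob_algebra[OF assms]])

text \<open>Fubini for nonnegative functions is \<open>nn_integral_bind\<close>; the real case
  subtracts the integrals of the positive and negative parts. Only almost every \<open>K x\<close>
  need integrate \<open>f\<close>; at the others the inner integral has its default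
  \<open>0\<close>, which the outer integral does not see.\<close>

lemma kernel_integral:
  fixes f :: "'b \<Rightarrow> real"
  assumes f: "integrable (M \<bind> K) f"
  shows "AE x in M. integrable (K x) f"
    and "integrable M (\<lambda>x. \<integral>y. f y \<partial>K x)"
    and "(\<integral>x. f x \<partial>(M \<bind> K)) = (\<integral>x. (\<integral>y. f y \<partial>K x) \<partial>M)"
proof -
  have fN [measurable]: "f \<in> borel_measurable N"
    using borel_measurable_integrable[OF f] measurable_cong_sets[OF kernel_bind_sets refl] by blast
  have fK: "f \<in> borel_measurable (K x)" if "x \<in> space M" for x
    using fN measurable_cong_sets[OF kernel_sets[OF that] refl] by blast
  note m = kernel_measurable_nn_integral kernel_measurable_integral
  have bind: "(\<integral>\<^sup>+x. g x \<partial>(M \<bind> K)) = (\<integral>\<^sup>+x. (\<integral>\<^sup>+y. g y \<partial>K x) \<partial>M)"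
    if "g \<in> borel_measurable N" for g
    using nn_integral_bind[OF that kernel_sub] .
  have fin: "(\<integral>\<^sup>+x. (\<integral>\<^sup>+y. norm (f y) \<partial>K x) \<partial>M) < \<infinity>"
    using f by (subst bind[symmetric]) (simp_all add: integrable_iff_bounded)
  then have "AE x in M. (\<integral>\<^sup>+y. norm (f y) \<partial>K x) \<noteq> \<infinity>"
    by (intro nn_integral_PInf_AE m) auto
  then show ae: "AE x in M. integrable (K x) f"
    using AE_space by eventually_elim (auto simp: integrable_iff_bounded fK less_top)
  \<comment> \<open>As \<open>ennreal\<close> sends negative reals to \<open>0\<close>, the values
    \<open>s = 1\<close> and \<open>s = -1\<close> produce the positive and the negative part of
    \<open>f\<close>.\<close>
  have fin2: "(\<integral>\<^sup>+x. (\<integral>\<^sup>+y. ennreal (s * f y) \<partial>K x) \<partial>M) < \<infinity>" if "\<bar>s\<bar> = 1" for s :: real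
  proof -
    have "s * f y \<le> norm (f y)" for y
      using that abs_ge_self[of "s * f y"] by (simp add: abs_mult)
    then show ?thesis
      by (intro le_less_trans[OF _ fin] nn_integral_mono) (simp add: ennreal_leI)
  qed
  have g: "integrable M (\<lambda>x. enn2real (\<integral>\<^sup>+y. ennreal (s * f y) \<partial>K x))"
    "(\<integral>x. enn2real (\<integral>\<^sup>+y. ennreal (s * f y) \<partial>K x) \<partial>M)
       = enn2real (\<integral>\<^sup>+x. ennreal (s * f x) \<partial>(M \<bind> K))" if s: "\<bar>s\<bar> = 1" for s :: real
  proof -
    have ms: "(\<lambda>x. \<integral>\<^sup>+y. ennreal (s * f y) \<partial>K x) \<in> borel_measurable M"
      by (intro m) auto
    have "AE x in M. (\<integral>\<^sup>+y. ennreal (s * f y) \<partial>K x) \<noteq> \<infinity>"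
      using fin2[OF s] by (intro nn_integral_PInf_AE ms) auto
    then have ae2: "AE x in M. ennreal (enn2real (\<integral>\<^sup>+y. ennreal (s * f y) \<partial>K x))
        = (\<integral>\<^sup>+y. ennreal (s * f y) \<partial>K x)"
      by eventually_elim (simp add: less_top)
    have eq: "(\<integral>\<^sup>+x. ennreal (enn2real (\<integral>\<^sup>+y. ennreal (s * f y) \<partial>K x)) \<partial>M)
        = (\<integral>\<^sup>+x. (\<integral>\<^sup>+y. ennreal (s * f y) \<partial>K x) \<partial>M)"
      by (rule nn_integral_cong_AE[OF ae2])
    show "integrable M (\<lambda>x. enn2real (\<integral>\<^sup>+y. ennreal (s * f y) \<partial>K x))"
      using fin2[OF s] ms by (simp add: integrable_iff_bounded eq)
    show "(\<integral>x. enn2real (\<integral>\<^sup>+y. ennreal (s * f y) \<partial>K x) \<partial>M)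
       = enn2real (\<integral>\<^sup>+x. ennreal (s * f x) \<partial>(M \<bind> K))"
      using ms by (subst integral_eq_nn_integral) (auto simp: eq bind)
  qed
  have ae3: "AE x in M. (\<integral>y. f y \<partial>K x)
     = enn2real (\<integral>\<^sup>+y. ennreal (f y) \<partial>K x) - enn2real (\<integral>\<^sup>+y. ennreal (- f y) \<partial>K x)"
    using ae by eventually_elim (rule real_lebesgue_integral_def)
  have int: "integrable M (\<lambda>x. enn2real (\<integral>\<^sup>+y. ennreal (f y) \<partial>K x)
      - enn2real (\<integral>\<^sup>+y. ennreal (- f y) \<partial>K x))"
    using g(1)[of 1] g(1)[of "-1"] by simp
  show "integrable M (\<lambda>x. \<integral>y. f y \<partial>K x)"
    using int m(2)[OF fN] ae3
    by (subst integrable_cong_AE) auto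
  have "(\<integral>x. (\<integral>y. f y \<partial>K x) \<partial>M) = (\<integral>x. enn2real (\<integral>\<^sup>+y. ennreal (f y) \<partial>K x)
      - enn2real (\<integral>\<^sup>+y. ennreal (- f y) \<partial>K x) \<partial>M)"
    using int m(2)[OF fN] ae3 by (intro integral_cong_AE) auto
  also have "\<dots> = (\<integral>x. f x \<partial>(M \<bind> K))"
    using g[of 1] g[of "-1"] by (simp add: real_lebesgue_integral_def[OF f])
  finally show "(\<integral>x. f x \<partial>(M \<bind> K)) = (\<integral>x. (\<integral>y. f y \<partial>K x) \<partial>M)" ..
qed

text \<open>Each \<open>K x\<close> is a probability measure, so the square of a mean is at most the
  mean of the square; integrating this over \<open>M\<close> makes averaging a contraction.\<close>

lemma kernel_L2:
  assumes f: "f \<in> L2 (M \<bind> K)"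
  shows "AE x in M. f \<in> L2 (K x)"
    and "(\<lambda>x. \<integral>y. f y \<partial>K x) \<in> L2 M"
    and "(\<integral>x. (\<integral>y. f y \<partial>K x)\<^sup>2 \<partial>M) \<le> (\<integral>x. (f x)\<^sup>2 \<partial>(M \<bind> K))"
proof -
  have fN: "f \<in> borel_measurable N"
    using L2_measurable[OF f] measurable_cong_sets[OF kernel_bind_sets refl] by blast
  note sq = kernel_integral[OF L2_square[OF f]]
  show ae: "AE x in M. f \<in> L2 (K x)"
    using sq(1) AE_space
  proof eventually_elim
    case (elim x)
    then show ?case
      using fN measurable_cong_sets[OF kernel_sets[of x] refl] by (auto intro: L2_I)
  qed
  have le: "AE x in M. (\<integral>y. f y \<partial>K x)\<^sup>2 \<le> (\<integral>y. (f y)\<^sup>2 \<partial>K x)"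
    using ae AE_space by eventually_elim (rule prob_space.L2_integral_square_le[OF kernel_prob])
  have m [measurable]: "(\<lambda>x. \<integral>y. f y \<partial>K x) \<in> borel_measurable M"
    by (rule kernel_measurable_integral[OF fN])
  have int: "integrable M (\<lambda>x. (\<integral>y. f y \<partial>K x)\<^sup>2)"
    using sq(2) by (rule Bochner_Integration.integrable_bound) (use le in auto)
  then show "(\<lambda>x. \<integral>y. f y \<partial>K x) \<in> L2 M"
    by (intro L2_I m)
  show "(\<integral>x. (\<integral>y. f y \<partial>K x)\<^sup>2 \<partial>M) \<le> (\<integral>x. (f x)\<^sup>2 \<partial>(M \<bind> K))"
    unfolding sq(3) by (rule integral_mono_AE[OF int sq(2) le])
qed

end

section \<open>Kernels with an invariant law: contraction, operator norm, splitting off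
  constants\<close>

locale invariant_kernel = prob_space M for M :: "'a measure" +
  fixes K :: "'a \<Rightarrow> 'a measure"
  assumes K: "K \<in> M \<rightarrow>\<^sub>M prob_algebra M"
    and bind_K: "M \<bind> K = M"
begin

lemma op_integral:
  assumes "integrable M f"
  shows "AE x in M. integrable (K x) f" "integrable M (kernel_op K f)"
    "(\<integral>x. kernel_op K f x \<partial>M) = (\<integral>x. f x \<partial>M)"
  using kernel_integral[OF prob_space_axioms K, of f] assms by (simp_all add: bind_K kernel_op_def)

lemma op_L2:
  assumes "f \<in> L2 M"
  shows "kernel_op K f \<in> L2 M"
    and "(\<integral>x. (kernel_op K f x)\<^sup>2 \<partial>M) \<le> (\<integral>x. (f x)\<^sup>2 \<partial>M)"
  using kernel_L2[OF prob_space_axioms K, of f] assms by (simp_all add: bind_K kernel_op_def[abs_def])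

text \<open>Twice the left side is at most the sum of the square norms of \<open>f\<close> and
  \<open>K f\<close>, and \<open>K\<close> is a contraction. This makes the quotients in
  \<open>Gap\<close> nonnegative.\<close>

lemma inner_op_le:
  assumes f: "f \<in> L2 M"
  shows "(\<integral>x. f x * kernel_op K f x \<partial>M) \<le> (\<integral>x. (f x)\<^sup>2 \<partial>M)"
proof -
  note Kf = op_L2(1)[OF f]
  have "(\<integral>x. 2 * (f x * kernel_op K f x) \<partial>M) \<le> (\<integral>x. (f x)\<^sup>2 + (kernel_op K f x)\<^sup>2 \<partial>M)"
    using L2_square[OF f] L2_square[OF Kf] L2_mult[OF f Kf] sum_squares_bound
    by (intro integral_mono) (auto simp: mult.assoc)
  also have "\<dots> \<le> 2 * (\<integral>x. (f x)\<^sup>2 \<partial>M)"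
    using L2_square[OF f] L2_square[OF Kf] op_L2(2)[OF f] by simp
  finally show ?thesis
    by simp
qed

lemma op_L2_0:
  assumes "f \<in> L2_0 M"
  shows "kernel_op K f \<in> L2_0 M"
  using assms by (auto simp: L2_0_eq op_L2 op_integral L2_integrable)

text \<open>Additivity can fail at points where \<open>K x\<close> integrates \<open>f\<close> or
  \<open>g\<close> only by the default value; invariance confines these points to a null
  set.\<close>

lemma op_diff_AE:
  assumes "f \<in> L2 M" "g \<in> L2 M"
  shows "AE x in M. kernel_op K (\<lambda>y. f y - g y) x = kernel_op K f x - kernel_op K g x"
  using op_integral(1)[OF L2_integrable[OF assms(1)]] op_integral(1)[OF L2_integrable[OF assms(2)]]
  by eventually_elim (simp add: kernel_op_def)

lemma op_const_AE: "AE x in M. kernel_op K (\<lambda>_. c) x = c"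
  using AE_space
proof eventually_elim
  case (elim x)
  interpret Kx: prob_space "K x"
    by (rule kernel_prob[OF prob_space_axioms K elim])
  show ?case
    by (simp add: kernel_op_def Kx.prob_space)
qed

lemma op_centred_AE:
  assumes "f \<in> L2 M"
  shows "AE x in M. kernel_op K (\<lambda>y. f y - c) x = kernel_op K f x - c"
  using op_diff_AE[OF assms L2_const[of c]] op_const_AE[of c] by eventually_elim simp

lemma L2_norm_square: "(l2_norm M f)\<^sup>2 = (\<integral>x. (f x)\<^sup>2 \<partial>M)"
  by (simp add: l2_norm_def l2_inner_def power2_eq_square[symmetric])

lemma op_unit_ball:
  assumes "f \<in> {f \<in> L2_0 M. l2_norm M f \<le> 1}"
  shows "l2_norm M (kernel_op K f) \<le> 1"
proof -
  from assms have f: "f \<in> L2 M" "l2_norm M f \<le> 1"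
    by (auto simp: L2_0_eq)
  have "l2_norm M (kernel_op K f) \<le> l2_norm M f"
    using op_L2(2)[OF f(1)]
    by (simp add: l2_norm_def l2_inner_def power2_eq_square)
  with f(2) show ?thesis
    by simp
qed

lemma op_norm_bdd:
  "bdd_above ((\<lambda>f. l2_norm M (kernel_op K f)) ` {f \<in> L2_0 M. l2_norm M f \<le> 1})"
  by (rule bdd_aboveI2) (rule op_unit_ball)

lemma op_norm_bounds: "0 \<le> op_norm M (kernel_op K)" "op_norm M (kernel_op K) \<le> 1"
proof -
  have z: "(\<lambda>_. 0) \<in> {f \<in> L2_0 M. l2_norm M f \<le> 1}"
    by (simp add: L2_0_def l2_norm_def l2_inner_def)
  have "0 \<le> l2_norm M (kernel_op K (\<lambda>_. 0))"
    by (simp add: l2_norm_def l2_inner_def)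
  then show "0 \<le> op_norm M (kernel_op K)"
    unfolding op_norm_def by (rule cSUP_upper2[OF op_norm_bdd z])
  show "op_norm M (kernel_op K) \<le> 1"
    unfolding op_norm_def
    using z by (intro cSUP_least op_unit_ball) auto
qed

text \<open>Scaling to norm \<open>1\<close> turns the supremum over the unit ball into a
  homogeneous bound. A function of norm \<open>0\<close> cannot be scaled, but contraction makes its
  image null too.\<close>

lemma op_norm_ge:
  assumes f: "f \<in> L2_0 M"
  shows "(\<integral>x. (kernel_op K f x)\<^sup>2 \<partial>M) \<le> (op_norm M (kernel_op K))\<^sup>2 * (\<integral>x. (f x)\<^sup>2 \<partial>M)"
proof -
  define s where "s = l2_norm M f"
  have s2: "s\<^sup>2 = (\<integral>x. (f x)\<^sup>2 \<partial>M)"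
    by (simp add: s_def L2_norm_square)
  have f2: "f \<in> L2 M" using f by (simp add: L2_0_eq)
  show ?thesis
  proof (cases "s = 0")
    case True
    then show ?thesis
      using op_L2(2)[OF f2] s2 by simp
  next
    case False
    have "0 \<le> s" by (simp add: s_def l2_norm_def l2_inner_def)
    with False have s: "0 < s" by simp
    define g where "g = (\<lambda>x. (1 / s) * f x)"
    have g: "g \<in> L2_0 M"
      using f L2_cmult[OF f2, of "1 / s"] unfolding g_def L2_0_eq by simp
    have "(l2_norm M g)\<^sup>2 = 1"
      unfolding L2_norm_square g_def power_mult_distrib
      using s by (simp add: s2[symmetric] power_divide)
    then have "l2_norm M g \<le> 1"
      by (simp add: power2_eq_1_iff) auto
    then have "l2_norm M (kernel_op K g) \<le> op_norm M (kernel_op K)"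
      unfolding op_norm_def using g by (intro cSUP_upper op_norm_bdd) auto
    then have "(l2_norm M (kernel_op K g))\<^sup>2 \<le> (op_norm M (kernel_op K))\<^sup>2"
      by (intro power_mono) (simp_all add: l2_norm_def l2_inner_def)
    moreover have "kernel_op K g = (\<lambda>x. (1 / s) * kernel_op K f x)"
      by (simp add: kernel_op_def g_def)
    then have "(l2_norm M (kernel_op K g))\<^sup>2 = (\<integral>x. (kernel_op K f x)\<^sup>2 \<partial>M) / s\<^sup>2"
      unfolding L2_norm_square by (simp add: power_divide)
    ultimately show ?thesis
      using s by (simp add: s2[symmetric] divide_le_eq)
  qed
qed

text \<open>Nonnegativity of \<open>b\<close> has to be required separately: if all mean-zero
  functions are null, the estimate says nothing about the sign of \<open>b\<close>.\<close>

lemma op_norm_square_le: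
  assumes le: "\<And>f. f \<in> L2_0 M \<Longrightarrow> (\<integral>x. (kernel_op K f x)\<^sup>2 \<partial>M) \<le> b * (\<integral>x. (f x)\<^sup>2 \<partial>M)"
    and b: "0 \<le> b"
  shows "(op_norm M (kernel_op K))\<^sup>2 \<le> b"
proof -
  have "op_norm M (kernel_op K) \<le> sqrt b"
    unfolding op_norm_def
  proof (rule cSUP_least)
    have "(\<lambda>_. 0) \<in> {f \<in> L2_0 M. l2_norm M f \<le> 1}"
      by (simp add: L2_0_def l2_norm_def l2_inner_def)
    then show "{f \<in> L2_0 M. l2_norm M f \<le> 1} \<noteq> {}"
      by blast
    fix f assume "f \<in> {f \<in> L2_0 M. l2_norm M f \<le> 1}"
    then have f: "f \<in> L2_0 M" "l2_norm M f \<le> 1"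
      by auto
    have "(l2_norm M f)\<^sup>2 \<le> 1"
      using f(2) by (intro power_le_one) (simp_all add: l2_norm_def l2_inner_def)
    then have "b * (\<integral>x. (f x)\<^sup>2 \<partial>M) \<le> b"
      using b by (simp add: L2_norm_square mult_left_le)
    with le[OF f(1)] have "(l2_norm M (kernel_op K f))\<^sup>2 \<le> b"
      by (simp add: L2_norm_square)
    then show "l2_norm M (kernel_op K f) \<le> sqrt b"
      by (rule real_le_rsqrt)
  qed
  then have "(op_norm M (kernel_op K))\<^sup>2 \<le> (sqrt b)\<^sup>2"
    using op_norm_bounds(1) by (intro power_mono)
  with b show ?thesis
    by simp
qed

lemma op_square_le:
  assumes f: "f \<in> L2 M" and c: "(op_norm M (kernel_op K))\<^sup>2 \<le> c"
  shows "(\<integral>x. (kernel_op K f x)\<^sup>2 \<partial>M)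
    \<le> (1 - c) * (\<integral>x. f x \<partial>M)\<^sup>2 + c * (\<integral>x. (f x)\<^sup>2 \<partial>M)"
proof -
  define a where "a = (\<integral>x. f x \<partial>M)"
  define g where "g = (\<lambda>x. f x - a)"
  have g: "g \<in> L2_0 M" "(\<integral>x. (g x)\<^sup>2 \<partial>M) = (\<integral>x. (f x)\<^sup>2 \<partial>M) - a\<^sup>2"
    using L2_centred[OF f] by (simp_all add: g_def a_def)
  have Kf: "kernel_op K f \<in> L2 M" and Kg: "kernel_op K g \<in> L2 M"
    using f g(1) by (simp_all add: op_L2 L2_0_eq)
  have "(\<integral>x. (kernel_op K f x)\<^sup>2 \<partial>M) - a\<^sup>2 = (\<integral>x. (kernel_op K f x - a)\<^sup>2 \<partial>M)"
    using L2_centred(2)[OF Kf] op_integral(3)[OF L2_integrable[OF f]] by (simp add: a_def)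
  also have "\<dots> = (\<integral>x. (kernel_op K g x)\<^sup>2 \<partial>M)"
    using op_centred_AE[OF f, of a] Kf Kg by (intro integral_cong_AE) (auto simp: g_def)
  also have "\<dots> \<le> (op_norm M (kernel_op K))\<^sup>2 * (\<integral>x. (g x)\<^sup>2 \<partial>M)"
    by (rule op_norm_ge[OF g(1)])
  also have "\<dots> \<le> c * ((\<integral>x. (f x)\<^sup>2 \<partial>M) - a\<^sup>2)"
    unfolding g(2)[symmetric] by (intro mult_right_mono c) simp
  finally show ?thesis
    by (simp add: a_def algebra_simps)
qed

lemma inner_centred:
  assumes f: "f \<in> L2 M" and g: "g \<in> L2 M"
  shows "(\<integral>x. f x * g x \<partial>M)
    = (\<integral>x. (f x - (\<integral>x. f x \<partial>M)) * (g x - (\<integral>x. g x \<partial>M)) \<partial>M) + (\<integral>x. f x \<partial>M) * (\<integral>x. g x \<partial>M)"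
proof -
  define a b where "a = (\<integral>x. f x \<partial>M)" "b = (\<integral>x. g x \<partial>M)"
  have "(\<integral>x. (f x - a) * (g x - b) \<partial>M) = (\<integral>x. f x * g x - b * f x - a * g x + a * b \<partial>M)"
    by (intro Bochner_Integration.integral_cong) (auto simp: algebra_simps)
  also have "\<dots> = (\<integral>x. f x * g x \<partial>M) - b * a - a * b + a * b"
    using L2_mult[OF f g] L2_integrable[OF f] L2_integrable[OF g] by (simp add: prob_space a_b_def)
  finally show ?thesis
    by (simp add: a_b_def)
qed

text \<open>The cross terms vanish because \<open>K\<close> fixes constants and preserves the mean.
  The remaining product of means is symmetric in \<open>f\<close> and \<open>g\<close>, so symmetry
  need only be known for mean-zero functions.\<close>

lemma inner_op_centred:
  assumes f: "f \<in> L2 M" and g: "g \<in> L2 M"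
  shows "(\<integral>x. f x * kernel_op K g x \<partial>M)
    = (\<integral>x. (f x - (\<integral>x. f x \<partial>M)) * kernel_op K (\<lambda>y. g y - (\<integral>x. g x \<partial>M)) x \<partial>M)
      + (\<integral>x. f x \<partial>M) * (\<integral>x. g x \<partial>M)"
proof -
  define a b where "a = (\<integral>x. f x \<partial>M)" "b = (\<integral>x. g x \<partial>M)"
  have Kg: "kernel_op K g \<in> L2 M" and Kg0: "kernel_op K (\<lambda>y. g y - b) \<in> L2 M"
    using g by (auto intro!: op_L2 L2_diff L2_const)
  have [measurable]: "f \<in> borel_measurable M"
    using f by measurable
  have "(\<integral>x. (f x - a) * (kernel_op K g x - b) \<partial>M)
      = (\<integral>x. (f x - a) * kernel_op K (\<lambda>y. g y - b) x \<partial>M)"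
    using op_centred_AE[OF g, of b] Kg Kg0 by (intro integral_cong_AE) auto
  then show ?thesis
    using inner_centred[OF f Kg] op_integral(3)[OF L2_integrable[OF g]] by (simp add: a_b_def)
qed

end

section \<open>Symmetry and positivity on all of \<open>L2\<close>\<close>

locale reversible_kernel = invariant_kernel +
  assumes self_adjoint_K: "self_adjoint M (kernel_op K)"
begin

lemma op_symmetric:
  assumes f: "f \<in> L2 M" and g: "g \<in> L2 M"
  shows "(\<integral>x. f x * kernel_op K g x \<partial>M) = (\<integral>x. kernel_op K f x * g x \<partial>M)"
proof -
  define f0 g0 where "f0 = (\<lambda>x. f x - (\<integral>x. f x \<partial>M))" "g0 = (\<lambda>x. g x - (\<integral>x. g x \<partial>M))"
  have "f0 \<in> L2_0 M" "g0 \<in> L2_0 M"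
    using L2_centred(1)[OF f] L2_centred(1)[OF g] by (simp_all add: f0_g0_def)
  then have "(\<integral>x. f0 x * kernel_op K g0 x \<partial>M) = (\<integral>x. kernel_op K f0 x * g0 x \<partial>M)"
    using self_adjoint_K unfolding self_adjoint_def l2_inner_def by blast
  also have "\<dots> = (\<integral>x. g0 x * kernel_op K f0 x \<partial>M)"
    by (simp only: mult.commute)
  finally have "(\<integral>x. f x * kernel_op K g x \<partial>M) = (\<integral>x. g x * kernel_op K f x \<partial>M)"
    unfolding inner_op_centred[OF f g] inner_op_centred[OF g f] f0_g0_def
    by (simp only: mult.commute[of "\<integral>x. f x \<partial>M"])
  also have "\<dots> = (\<integral>x. kernel_op K f x * g x \<partial>M)"
    by (simp only: mult.commute)
  finally show ?thesis .
qed

text \<open>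
  For \<open>f\<close> of mean zero, positivity is applied to \<open>f - K f\<close>: together with \<open>\<parallel>K\<parallel> \<le> 1\<close> it gives
  \<open>\<langle>f, K f\<rangle> - \<parallel>K f\<parallel>\<^sup>2 \<ge> \<parallel>K f\<parallel>\<^sup>2 - \<langle>K f, K (K f)\<rangle> \<ge> 0\<close>.
\<close>

lemma op_square_le_inner:
  assumes pos: "pos_semidef M (kernel_op K)" and f: "f \<in> L2 M"
  shows "(\<integral>x. (kernel_op K f x)\<^sup>2 \<partial>M) \<le> (\<integral>x. f x * kernel_op K f x \<partial>M)"
proof -
  have zero: "(\<integral>x. (kernel_op K g x)\<^sup>2 \<partial>M) \<le> (\<integral>x. g x * kernel_op K g x \<partial>M)"
    if g0: "g \<in> L2_0 M" for g
  proof -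
    define u v where "u = kernel_op K g" "v = kernel_op K u"
    have g: "g \<in> L2 M" and u: "u \<in> L2 M" and v: "v \<in> L2 M" and u0: "u \<in> L2_0 M"
      using g0 op_L2_0[OF g0] by (simp_all add: u_v_def op_L2 L2_0_eq)
    have d0: "(\<lambda>x. g x - u x) \<in> L2_0 M"
      using g0 u0 by (auto simp: L2_0_eq L2_diff L2_integrable)
    then have d: "(\<lambda>x. g x - u x) \<in> L2 M"
      by (simp add: L2_0_eq)
    note ints = L2_mult[OF g u] L2_mult[OF g v] L2_mult[OF u u] L2_mult[OF u v]
    have "0 \<le> (\<integral>x. (g x - u x) * kernel_op K (\<lambda>x. g x - u x) x \<partial>M)"
      using pos d0 by (simp add: pos_semidef_def l2_inner_def)
    also have "\<dots> = (\<integral>x. (g x - u x) * (u x - v x) \<partial>M)"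
      using op_diff_AE[OF g u] d u v op_L2(1)[OF d]
      by (intro integral_cong_AE) (auto simp: u_v_def)
    also have "\<dots> = (\<integral>x. g x * u x - g x * v x - u x * u x + u x * v x \<partial>M)"
      by (simp add: algebra_simps)
    also have "\<dots> = (\<integral>x. g x * u x \<partial>M) - (\<integral>x. g x * v x \<partial>M) - (\<integral>x. u x * u x \<partial>M)
        + (\<integral>x. u x * v x \<partial>M)"
      using ints by simp
    also have "(\<integral>x. g x * v x \<partial>M) = (\<integral>x. u x * u x \<partial>M)"
      using op_symmetric[OF g u] by (simp add: u_v_def)
    finally have "0 \<le> (\<integral>x. g x * u x \<partial>M) - 2 * (\<integral>x. u x * u x \<partial>M) + (\<integral>x. u x * v x \<partial>M)"
      by simp
    then show ?thesis
      using inner_op_le[OF u] by (simp add: power2_eq_square u_v_def)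
  qed
  \<comment> \<open>Centring subtracts the same \<open>a^2\<close> from both sides, so the mean-zero
    case suffices.\<close>
  define a where "a = (\<integral>x. f x \<partial>M)"
  define g where "g = (\<lambda>x. f x - a)"
  have g0: "g \<in> L2_0 M"
    using L2_centred(1)[OF f] by (simp add: g_def a_def)
  have Kf: "kernel_op K f \<in> L2 M" and Kg: "kernel_op K g \<in> L2 M"
    using f g0 by (simp_all add: op_L2 L2_0_eq)
  have "(\<integral>x. (kernel_op K f x)\<^sup>2 \<partial>M) - a\<^sup>2 = (\<integral>x. (kernel_op K f x - a)\<^sup>2 \<partial>M)"
    using L2_centred(2)[OF Kf] op_integral(3)[OF L2_integrable[OF f]] by (simp add: a_def)
  also have "\<dots> = (\<integral>x. (kernel_op K g x)\<^sup>2 \<partial>M)"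
    using op_centred_AE[OF f, of a] Kf Kg by (intro integral_cong_AE) (auto simp: g_def)
  also have "\<dots> \<le> (\<integral>x. g x * kernel_op K g x \<partial>M)"
    by (rule zero[OF g0])
  also have "\<dots> = (\<integral>x. f x * kernel_op K f x \<partial>M) - a\<^sup>2"
    using inner_op_centred[OF f f] by (simp add: g_def a_def power2_eq_square)
  finally show ?thesis
    by simp
qed

end

section \<open>Disintegrations\<close>

text \<open>\<open>M\<close> is the base, \<open>\<kappa> x\<close> the conditional law on the fibre
  over \<open>x\<close>, and \<open>Z\<close> the space carrying the joint law. The embedding
  \<open>e\<close> is a parameter so that either coordinate of a product can serve as the
  base.\<close>

locale fibration = prob_space M for M :: "'a measure" +
  fixes N :: "'b measure" and Z :: "'c measure"
    and \<kappa> :: "'a \<Rightarrow> 'b measure" and e :: "'a \<Rightarrow> 'b \<Rightarrow> 'c"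
  assumes kappa: "\<kappa> \<in> M \<rightarrow>\<^sub>M prob_algebra N"
    and embed: "(\<lambda>(x, y). e x y) \<in> M \<Otimes>\<^sub>M N \<rightarrow>\<^sub>M Z"
begin

definition fibre :: "'a \<Rightarrow> 'c measure" where
  "fibre x = distr (\<kappa> x) Z (e x)"

definition total :: "'c measure" where
  "total = M \<bind> fibre"

lemmas sets_kappa = kernel_sets[OF prob_space_axioms kappa]
lemmas space_kappa = kernel_space[OF prob_space_axioms kappa]
lemmas prob_kappa = kernel_prob[OF prob_space_axioms kappa]

lemma embed_measurable: "x \<in> space M \<Longrightarrow> e x \<in> N \<rightarrow>\<^sub>M Z"
  using measurable_compose[OF measurable_Pair1' embed] by simp

lemma embed_measurable': "x \<in> space M \<Longrightarrow> sets L = sets N \<Longrightarrow> e x \<in> L \<rightarrow>\<^sub>M Z"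
  using embed_measurable measurable_cong_sets by blast

lemma fibre: "fibre \<in> M \<rightarrow>\<^sub>M prob_algebra Z"
  unfolding fibre_def[abs_def] by (rule measurable_distr_prob_space2[OF kappa embed])

lemma sets_total: "sets total = sets Z"
  unfolding total_def by (rule kernel_bind_sets[OF prob_space_axioms fibre])

lemma prob_total: "prob_space total"
  unfolding total_def by (rule kernel_bind_prob[OF prob_space_axioms fibre])

lemma measurable_total: "borel_measurable total = borel_measurable Z"
  by (rule measurable_cong_sets[OF sets_total refl])

lemma integral_fibre:
  fixes f :: "'c \<Rightarrow> real"
  assumes "x \<in> space M" "f \<in> borel_measurable Z"
  shows "(\<integral>z. f z \<partial>fibre x) = (\<integral>y. f (e x y) \<partial>\<kappa> x)"
  unfolding fibre_def using assms by (intro integral_distr embed_measurable' sets_kappa)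

lemma total_integral:
  fixes f :: "'c \<Rightarrow> real"
  assumes f: "integrable total f"
  shows "AE x in M. integrable (\<kappa> x) (\<lambda>y. f (e x y))"
    and "integrable M (\<lambda>x. \<integral>y. f (e x y) \<partial>\<kappa> x)"
    and "(\<integral>z. f z \<partial>total) = (\<integral>x. (\<integral>y. f (e x y) \<partial>\<kappa> x) \<partial>M)"
proof -
  have fZ: "f \<in> borel_measurable Z"
    using borel_measurable_integrable[OF f] by (simp add: measurable_total)
  note int = kernel_integral[OF prob_space_axioms fibre f[unfolded total_def]]
  show "AE x in M. integrable (\<kappa> x) (\<lambda>y. f (e x y))"
    using int(1) AE_space
  proof eventually_elim
    case (elim x)
    then show ?case
      using embed_measurable'[OF elim(2) sets_kappa[OF elim(2)]] fZ
      by (simp add: fibre_def integrable_distr_eq)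
  qed
  show "integrable M (\<lambda>x. \<integral>y. f (e x y) \<partial>\<kappa> x)"
    using int(2) by (simp add: integral_fibre[OF _ fZ] cong: Bochner_Integration.integrable_cong)
  show "(\<integral>z. f z \<partial>total) = (\<integral>x. (\<integral>y. f (e x y) \<partial>\<kappa> x) \<partial>M)"
    using int(3) by (simp add: total_def integral_fibre[OF _ fZ] cong: Bochner_Integration.integral_cong)
qed

lemma total_L2:
  assumes f: "f \<in> L2 total"
  shows "AE x in M. (\<lambda>y. f (e x y)) \<in> L2 (\<kappa> x)"
    and "(\<lambda>x. \<integral>y. f (e x y) \<partial>\<kappa> x) \<in> L2 M"
proof -
  have fZ: "f \<in> borel_measurable Z"
    using L2_measurable[OF f] by (simp add: measurable_total)
  show "AE x in M. (\<lambda>y. f (e x y)) \<in> L2 (\<kappa> x)"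
    using total_integral(1)[OF L2_square[OF f]] AE_space
  proof eventually_elim
    case (elim x)
    then show ?case
      using measurable_compose[OF embed_measurable'[OF elim(2) sets_kappa[OF elim(2)]] fZ]
      by (intro L2_I)
  qed
  show "(\<lambda>x. \<integral>y. f (e x y) \<partial>\<kappa> x) \<in> L2 M"
    using kernel_L2(2)[OF prob_space_axioms fibre f[unfolded total_def]]
    by (simp add: L2_def integral_fibre[OF _ fZ]
        cong: Bochner_Integration.integrable_cong measurable_cong)
qed

end

text \<open>The abstract form of resampling one coordinate: \<open>K\<close> never leaves a fibre.
  Its operator is a direct integral of the operators of \<open>H x\<close>, so fibrewise symmetry,
  positivity and norm bounds pass to the total space by integration over the base.\<close>

locale fibred_kernel = fibration +
  fixes H :: "'a \<Rightarrow> 'b \<Rightarrow> 'b measure" and K :: "'c \<Rightarrow> 'c measure"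
  assumes H: "x \<in> space M \<Longrightarrow> reversible_kernel (\<kappa> x) (H x)"
    and kernel_K: "K \<in> Z \<rightarrow>\<^sub>M prob_algebra Z"
    and K_embed: "x \<in> space M \<Longrightarrow> y \<in> space N \<Longrightarrow> K (e x y) = distr (H x y) Z (e x)"
begin

lemma invariant_kernel_H: "x \<in> space M \<Longrightarrow> invariant_kernel (\<kappa> x) (H x)"
  using H by (rule reversible_kernel.axioms)

lemma kernel_H: "x \<in> space M \<Longrightarrow> H x \<in> \<kappa> x \<rightarrow>\<^sub>M prob_algebra (\<kappa> x)"
  using invariant_kernel_H by (rule invariant_kernel.K)

lemma sets_H: "x \<in> space M \<Longrightarrow> y \<in> space N \<Longrightarrow> sets (H x y) = sets N"
  using kernel_sets[OF prob_kappa kernel_H, of x y] by (simp add: space_kappa sets_kappa)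

lemma op_embed:
  assumes "x \<in> space M" "y \<in> space N" "g \<in> borel_measurable Z"
  shows "kernel_op K g (e x y) = kernel_op (H x) (\<lambda>y. g (e x y)) y"
  unfolding kernel_op_def K_embed[OF assms(1,2)]
  using assms by (intro integral_distr embed_measurable' sets_H)

text \<open>Every single fibre law is already invariant under \<open>K\<close>, because
  \<open>H x\<close> preserves \<open>\<kappa> x\<close>; mixing over the base keeps this.\<close>

lemma bind_total: "total \<bind> K = total"
proof -
  have "fibre x \<bind> K = fibre x" if x: "x \<in> space M" for x
  proof -
    have ne: "space (\<kappa> x) \<noteq> {}"
      using prob_kappa[OF x] by (rule prob_space.not_empty)
    have "fibre x \<bind> K = \<kappa> x \<bind> (\<lambda>y. K (e x y))"
      unfolding fibre_def
      by (rule bind_distr[OF embed_measurable'[OF x sets_kappa[OF x]] measurable_prob_algebraD[OF kernel_K] ne])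
    also have "\<dots> = \<kappa> x \<bind> (\<lambda>y. distr (H x y) Z (e x))"
      using x by (intro bind_cong refl) (simp add: K_embed space_kappa)
    also have "\<dots> = distr (\<kappa> x \<bind> H x) Z (e x)"
      by (rule distr_bind[symmetric, OF measurable_prob_algebraD[OF kernel_H[OF x]] ne
            embed_measurable'[OF x sets_kappa[OF x]]])
    also have "\<dots> = fibre x"
      by (simp add: invariant_kernel.bind_K[OF invariant_kernel_H[OF x]] fibre_def)
    finally show ?thesis .
  qed
  moreover have "total \<bind> K = M \<bind> (\<lambda>x. fibre x \<bind> K)"
    unfolding total_def
    by (rule bind_assoc[OF measurable_prob_algebraD[OF fibre] measurable_prob_algebraD[OF kernel_K]])
  ultimately show ?thesis
    unfolding total_def by (simp cong: bind_cong)
qed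

sublocale total: invariant_kernel total K
proof (intro invariant_kernel.intro invariant_kernel_axioms.intro prob_total bind_total)
  show "K \<in> total \<rightarrow>\<^sub>M prob_algebra total"
    using kernel_K unfolding measurable_cong_sets[OF sets_total refl]
    by (simp add: prob_algebra_def subprob_algebra_cong[OF sets_total])
qed

lemma inner_total:
  assumes f: "f \<in> L2 total" and g: "g \<in> L2 total"
  shows "(\<integral>z. f z * kernel_op K g z \<partial>total)
    = (\<integral>x. (\<integral>y. f (e x y) * kernel_op (H x) (\<lambda>y. g (e x y)) y \<partial>\<kappa> x) \<partial>M)"
    and "integrable M (\<lambda>x. \<integral>y. f (e x y) * kernel_op (H x) (\<lambda>y. g (e x y)) y \<partial>\<kappa> x)"
proof -
  have gZ: "g \<in> borel_measurable Z"
    using L2_measurable[OF g] by (simp add: measurable_total)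
  have eq: "(\<integral>y. f (e x y) * kernel_op K g (e x y) \<partial>\<kappa> x)
      = (\<integral>y. f (e x y) * kernel_op (H x) (\<lambda>y. g (e x y)) y \<partial>\<kappa> x)" if "x \<in> space M" for x
    using that by (intro Bochner_Integration.integral_cong) (simp_all add: op_embed gZ space_kappa)
  note int = total_integral[OF L2_mult[OF f total.op_L2(1)[OF g]]]
  show "(\<integral>z. f z * kernel_op K g z \<partial>total)
    = (\<integral>x. (\<integral>y. f (e x y) * kernel_op (H x) (\<lambda>y. g (e x y)) y \<partial>\<kappa> x) \<partial>M)"
    using int(3) by (simp add: eq cong: Bochner_Integration.integral_cong)
  show "integrable M (\<lambda>x. \<integral>y. f (e x y) * kernel_op (H x) (\<lambda>y. g (e x y)) y \<partial>\<kappa> x)"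
    using int(2) by (simp add: eq cong: Bochner_Integration.integrable_cong)
qed

lemma square_total:
  assumes g: "g \<in> L2 total"
  shows "(\<integral>z. (kernel_op K g z)\<^sup>2 \<partial>total)
    = (\<integral>x. (\<integral>y. (kernel_op (H x) (\<lambda>y. g (e x y)) y)\<^sup>2 \<partial>\<kappa> x) \<partial>M)"
    and "integrable M (\<lambda>x. \<integral>y. (kernel_op (H x) (\<lambda>y. g (e x y)) y)\<^sup>2 \<partial>\<kappa> x)"
proof -
  have gZ: "g \<in> borel_measurable Z"
    using L2_measurable[OF g] by (simp add: measurable_total)
  have eq: "(\<integral>y. (kernel_op K g (e x y))\<^sup>2 \<partial>\<kappa> x)
      = (\<integral>y. (kernel_op (H x) (\<lambda>y. g (e x y)) y)\<^sup>2 \<partial>\<kappa> x)" if "x \<in> space M" for x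
    using that by (intro Bochner_Integration.integral_cong) (simp_all add: op_embed gZ space_kappa)
  note int = total_integral[OF L2_square[OF total.op_L2(1)[OF g]]]
  show "(\<integral>z. (kernel_op K g z)\<^sup>2 \<partial>total)
    = (\<integral>x. (\<integral>y. (kernel_op (H x) (\<lambda>y. g (e x y)) y)\<^sup>2 \<partial>\<kappa> x) \<partial>M)"
    using int(3) by (simp add: eq cong: Bochner_Integration.integral_cong)
  show "integrable M (\<lambda>x. \<integral>y. (kernel_op (H x) (\<lambda>y. g (e x y)) y)\<^sup>2 \<partial>\<kappa> x)"
    using int(2) by (simp add: eq cong: Bochner_Integration.integrable_cong)
qed

lemma total_op_symmetric:
  assumes f: "f \<in> L2 total" and g: "g \<in> L2 total"
  shows "(\<integral>z. f z * kernel_op K g z \<partial>total) = (\<integral>z. g z * kernel_op K f z \<partial>total)"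
  unfolding inner_total[OF f g] inner_total[OF g f]
proof (rule integral_cong_AE)
  show "AE x in M. (\<integral>y. f (e x y) * kernel_op (H x) (\<lambda>y. g (e x y)) y \<partial>\<kappa> x)
      = (\<integral>y. g (e x y) * kernel_op (H x) (\<lambda>y. f (e x y)) y \<partial>\<kappa> x)"
    using total_L2(1)[OF f] total_L2(1)[OF g] AE_space
  proof eventually_elim
    case (elim x)
    show ?case
      using reversible_kernel.op_symmetric[OF H[OF elim(3)] elim(1,2)] by (simp add: mult.commute)
  qed
qed (use inner_total(2)[OF f g] inner_total(2)[OF g f] in auto)

sublocale total: reversible_kernel total K
proof
  show "self_adjoint total (kernel_op K)"
    unfolding self_adjoint_def l2_inner_def
  proof (intro ballI)
    fix f g assume "f \<in> L2_0 total" "g \<in> L2_0 total"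
    then show "(\<integral>z. f z * kernel_op K g z \<partial>total) = (\<integral>z. kernel_op K f z * g z \<partial>total)"
      using total_op_symmetric[of f g] by (simp add: L2_0_eq mult.commute)
  qed
qed

text \<open>The fibrewise bound is integrated over the base. A constant \<open>c\<close> stands in
  for the fibre norms, whose dependence on \<open>x\<close> may be non-measurable.\<close>

lemma total_op_square_le:
  assumes g: "g \<in> L2 total"
    and c: "AE x in M. (op_norm (\<kappa> x) (kernel_op (H x)))\<^sup>2 \<le> c"
  shows "(\<integral>z. (kernel_op K g z)\<^sup>2 \<partial>total)
    \<le> (1 - c) * (\<integral>x. (\<integral>y. g (e x y) \<partial>\<kappa> x)\<^sup>2 \<partial>M) + c * (\<integral>z. (g z)\<^sup>2 \<partial>total)"
proof -
  note sq = total_integral[OF L2_square[OF g]]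
  note P = L2_square[OF total_L2(2)[OF g]]
  have "(\<integral>z. (kernel_op K g z)\<^sup>2 \<partial>total)
      \<le> (\<integral>x. (1 - c) * (\<integral>y. g (e x y) \<partial>\<kappa> x)\<^sup>2 + c * (\<integral>y. (g (e x y))\<^sup>2 \<partial>\<kappa> x) \<partial>M)"
    unfolding square_total(1)[OF g]
  proof (rule integral_mono_AE[OF square_total(2)[OF g]])
    show "AE x in M. (\<integral>y. (kernel_op (H x) (\<lambda>y. g (e x y)) y)\<^sup>2 \<partial>\<kappa> x)
        \<le> (1 - c) * (\<integral>y. g (e x y) \<partial>\<kappa> x)\<^sup>2 + c * (\<integral>y. (g (e x y))\<^sup>2 \<partial>\<kappa> x)"
      using total_L2(1)[OF g] c AE_space
      by eventually_elim (rule invariant_kernel.op_square_le[OF invariant_kernel_H])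
  qed (use sq(2) P in simp)
  then show ?thesis
    using sq P by simp
qed

lemma total_op_square_le_inner:
  assumes f: "f \<in> L2 total"
    and pos: "AE x in M. pos_semidef (\<kappa> x) (kernel_op (H x))"
  shows "(\<integral>z. (kernel_op K f z)\<^sup>2 \<partial>total) \<le> (\<integral>z. f z * kernel_op K f z \<partial>total)"
  unfolding square_total(1)[OF f] inner_total(1)[OF f f]
proof (rule integral_mono_AE[OF square_total(2)[OF f] inner_total(2)[OF f f]])
  show "AE x in M. (\<integral>y. (kernel_op (H x) (\<lambda>y. f (e x y)) y)\<^sup>2 \<partial>\<kappa> x)
      \<le> (\<integral>y. f (e x y) * kernel_op (H x) (\<lambda>y. f (e x y)) y \<partial>\<kappa> x)"
    using total_L2(1)[OF f] pos AE_space
    by eventually_elim (rule reversible_kernel.op_square_le_inner[OF H])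
qed

end

section \<open>Composition of invariant kernels\<close>

text \<open>Writing an integral against \<open>K w \<bind> L\<close> as an iterated one needs
  \<open>f\<close> to be integrable under \<open>T w\<close>; invariance of \<open>T\<close> grants
  this for almost every \<open>w\<close>.\<close>

lemma
  assumes K: "invariant_kernel M K" and L: "invariant_kernel M L"
    and T: "\<And>w. w \<in> space M \<Longrightarrow> T w = K w \<bind> L"
  shows invariant_kernel_comp: "invariant_kernel M T"
    and kernel_op_comp_AE: "f \<in> L2 M \<Longrightarrow> AE w in M. kernel_op T f w = kernel_op K (kernel_op L f) w"
proof -
  interpret K: invariant_kernel M K by fact
  interpret L: invariant_kernel M L by fact
  show inv: "invariant_kernel M T"
  proof unfold_locales
    have "(\<lambda>w. K w \<bind> L) \<in> M \<rightarrow>\<^sub>M prob_algebra M"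
      by (rule measurable_bind_prob_space[OF K.K L.K])
    then show "T \<in> M \<rightarrow>\<^sub>M prob_algebra M"
      by (simp add: T cong: measurable_cong)
    have "M \<bind> T = M \<bind> (\<lambda>w. K w \<bind> L)"
      by (intro bind_cong refl T)
    also have "\<dots> = M"
      using bind_assoc[OF measurable_prob_algebraD[OF K.K] measurable_prob_algebraD[OF L.K]]
      by (simp add: K.bind_K L.bind_K)
    finally show "M \<bind> T = M" .
  qed
  interpret T: invariant_kernel M T by (rule inv)
  assume f: "f \<in> L2 M"
  show "AE w in M. kernel_op T f w = kernel_op K (kernel_op L f) w"
    using T.op_integral(1)[OF K.L2_integrable[OF f]] AE_space
  proof eventually_elim
    case (elim w)
    have "L \<in> K w \<rightarrow>\<^sub>M prob_algebra M"
      using L.K measurable_cong_sets[OF kernel_sets[OF K.prob_space_axioms K.K elim(2)] refl] by blast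
    then show ?case
      using kernel_integral(3)[OF kernel_prob[OF K.prob_space_axioms K.K elim(2)], of L M f] elim
      by (simp add: T kernel_op_def)
  qed
qed

text \<open>Self-adjointness moves one factor \<open>K\<close> to the other argument. The result is
  symmetric in \<open>f\<close> and \<open>g\<close>, hence reversibility, and for
  \<open>f = g\<close> it is a square norm, hence positivity.\<close>

lemma (in reversible_kernel)
  assumes T: "\<And>w. w \<in> space M \<Longrightarrow> T w = K w \<bind> K"
  shows reversible_kernel_two_step: "reversible_kernel M T"
    and inner_two_step: "f \<in> L2 M \<Longrightarrow> g \<in> L2 M \<Longrightarrow>
      (\<integral>x. f x * kernel_op T g x \<partial>M) = (\<integral>x. kernel_op K f x * kernel_op K g x \<partial>M)"
proof -
  have ax: "invariant_kernel M K" by unfold_locales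
  interpret T: invariant_kernel M T
    by (rule invariant_kernel_comp[OF ax ax T])
  have inner: "(\<integral>x. f x * kernel_op T g x \<partial>M) = (\<integral>x. kernel_op K f x * kernel_op K g x \<partial>M)"
    if f: "f \<in> L2 M" and g: "g \<in> L2 M" for f g
  proof -
    have "(\<integral>x. f x * kernel_op T g x \<partial>M) = (\<integral>x. f x * kernel_op K (kernel_op K g) x \<partial>M)"
      using kernel_op_comp_AE[OF ax ax T g] L2_measurable[OF f] L2_measurable[OF T.op_L2(1)[OF g]]
        L2_measurable[OF op_L2(1)[OF op_L2(1)[OF g]]]
      by (intro integral_cong_AE) auto
    also have "\<dots> = (\<integral>x. kernel_op K f x * kernel_op K g x \<partial>M)"
      by (rule op_symmetric[OF f op_L2(1)[OF g]])
    finally show ?thesis .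
  qed
  then show "f \<in> L2 M \<Longrightarrow> g \<in> L2 M \<Longrightarrow>
    (\<integral>x. f x * kernel_op T g x \<partial>M) = (\<integral>x. kernel_op K f x * kernel_op K g x \<partial>M)" .
  show "reversible_kernel M T"
  proof unfold_locales
    show "self_adjoint M (kernel_op T)"
      unfolding self_adjoint_def l2_inner_def
    proof (intro ballI)
      fix f g assume fg: "f \<in> L2_0 M" "g \<in> L2_0 M"
      then have "(\<integral>x. g x * kernel_op T f x \<partial>M) = (\<integral>x. kernel_op K g x * kernel_op K f x \<partial>M)"
        by (intro inner) (simp_all add: L2_0_eq)
      with inner[of f g] fg show "(\<integral>x. f x * kernel_op T g x \<partial>M) = (\<integral>x. kernel_op T f x * g x \<partial>M)"
        by (simp add: L2_0_eq mult.commute)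
    qed
  qed
qed

section \<open>Kernels induced on the base of a disintegration\<close>

text \<open>\<open>p\<close> recovers the base point, so composing with \<open>p\<close> embeds
  \<open>L2 M\<close> isometrically into \<open>L2 total\<close> as the functions constant on
  fibres.\<close>

locale fibration_proj = fibration +
  fixes p :: "'c \<Rightarrow> 'a"
  assumes proj: "p \<in> Z \<rightarrow>\<^sub>M M"
    and proj_embed: "x \<in> space M \<Longrightarrow> y \<in> space N \<Longrightarrow> p (e x y) = x"
begin

lemma proj_total: "p \<in> total \<rightarrow>\<^sub>M M"
  using proj measurable_cong_sets[OF sets_total refl] by blast

lemma distr_total: "distr total M p = M"
proof -
  have "distr (fibre x) M p = return M x" if x: "x \<in> space M" for x
  proof -
    have "distr (fibre x) M p = distr (\<kappa> x) M (\<lambda>y. p (e x y))"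
      unfolding fibre_def
      using distr_distr[OF proj embed_measurable'[OF x sets_kappa[OF x]]] by (simp add: comp_def)
    also have "\<dots> = distr (\<kappa> x) M (\<lambda>_. x)"
      using x by (intro distr_cong refl) (simp add: proj_embed space_kappa)
    also have "\<dots> = return M x"
      by (rule prob_space.distr_const[OF prob_kappa[OF x] x])
    finally show ?thesis .
  qed
  then have "distr total M p = M \<bind> return M"
    unfolding total_def distr_bind[OF measurable_prob_algebraD[OF fibre] not_empty proj]
    by (intro bind_cong refl)
  then show ?thesis
    by (simp add: bind_return'')
qed

lemma lift_L2:
  assumes h: "h \<in> L2 M"
  shows "(\<lambda>z. h (p z)) \<in> L2 total"
proof (rule L2_I)
  show "(\<lambda>z. h (p z)) \<in> borel_measurable total"
    by (rule measurable_compose[OF proj_total L2_measurable[OF h]])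
  have "integrable (distr total M p) (\<lambda>x. (h x)\<^sup>2)"
    by (simp add: distr_total L2_square[OF h])
  then show "integrable total (\<lambda>z. (h (p z))\<^sup>2)"
    by (rule integrable_distr[OF proj_total])
qed

text \<open>On each fibre \<open>h (p z)\<close> is a constant and leaves the inner integral:
  lifting along \<open>p\<close> is adjoint to averaging over fibres.\<close>

lemma inner_lift:
  assumes h: "h \<in> L2 M" and f: "f \<in> L2 total"
  shows "(\<integral>z. h (p z) * f z \<partial>total) = (\<integral>x. h x * (\<integral>y. f (e x y) \<partial>\<kappa> x) \<partial>M)"
proof -
  have "(\<integral>y. h (p (e x y)) * f (e x y) \<partial>\<kappa> x) = h x * (\<integral>y. f (e x y) \<partial>\<kappa> x)"
    if x: "x \<in> space M" for x
  proof -
    have "(\<integral>y. h (p (e x y)) * f (e x y) \<partial>\<kappa> x) = (\<integral>y. h x * f (e x y) \<partial>\<kappa> x)"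
      using x by (intro Bochner_Integration.integral_cong) (simp_all add: proj_embed space_kappa)
    then show ?thesis
      by simp
  qed
  then show ?thesis
    using total_integral(3)[OF L2_mult[OF lift_L2[OF h] f]]
    by (simp cong: Bochner_Integration.integral_cong)
qed

text \<open>\<open>S\<close> is the compression of \<open>G\<close> to functions of the base point:
  lift along \<open>p\<close>, apply \<open>G\<close>, average over the fibre. Here \<open>G\<close>
  may change fibres; it is used for \<open>K2\<close> and its two-step kernel over the base \<phi>2,
  which gives the two averaged kernels.\<close>

context
  fixes G :: "'c \<Rightarrow> 'c measure" and S :: "'a \<Rightarrow> 'a measure"
  assumes G: "reversible_kernel total G"
    and S: "x \<in> space M \<Longrightarrow> S x = distr (fibre x \<bind> G) M p"
begin

interpretation G: reversible_kernel total G by (rule G)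

lemma kernel_lifted: "G \<in> Z \<rightarrow>\<^sub>M prob_algebra Z"
  using G.K unfolding measurable_cong_sets[OF sets_total refl]
  by (simp add: prob_algebra_def subprob_algebra_cong[OF sets_total])

lemma fibre_bind: "(\<lambda>x. fibre x \<bind> G) \<in> M \<rightarrow>\<^sub>M prob_algebra Z"
  by (rule measurable_bind_prob_space[OF fibre kernel_lifted])

lemma bind_fibre_bind: "M \<bind> (\<lambda>x. fibre x \<bind> G) = total"
  using bind_assoc[OF measurable_prob_algebraD[OF fibre] measurable_prob_algebraD[OF kernel_lifted]]
    G.bind_K unfolding total_def by simp

lemma invariant_kernel_base: "invariant_kernel M S"
proof unfold_locales
  have "(\<lambda>x. distr (fibre x \<bind> G) M p) \<in> M \<rightarrow>\<^sub>M prob_algebra M"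
    by (rule measurable_compose[OF fibre_bind measurable_distr_prob_space[OF proj]])
  then show "S \<in> M \<rightarrow>\<^sub>M prob_algebra M"
    by (simp add: S cong: measurable_cong)
  have "M \<bind> S = M \<bind> (\<lambda>x. distr (fibre x \<bind> G) M p)"
    by (intro bind_cong refl S)
  also have "\<dots> = distr (M \<bind> (\<lambda>x. fibre x \<bind> G)) M p"
    by (rule distr_bind[symmetric, OF measurable_prob_algebraD[OF fibre_bind] not_empty proj])
  also have "\<dots> = M"
    by (simp add: bind_fibre_bind distr_total)
  finally show "M \<bind> S = M" .
qed

lemma op_base_AE:
  assumes h: "h \<in> L2 M"
  shows "AE x in M. kernel_op S h x = (\<integral>y. kernel_op G (\<lambda>z. h (p z)) (e x y) \<partial>\<kappa> x)"
proof -
  let ?h = "\<lambda>z. h (p z)"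
  have hZ: "?h \<in> borel_measurable Z" and hM: "h \<in> borel_measurable M"
    using L2_measurable[OF lift_L2[OF h]] L2_measurable[OF h] by (simp_all add: measurable_total)
  have GhZ: "kernel_op G ?h \<in> borel_measurable Z"
    using L2_measurable[OF G.op_L2(1)[OF lift_L2[OF h]]] by (simp add: measurable_total)
  have "AE x in M. integrable (fibre x \<bind> G) ?h"
    using G.L2_integrable[OF lift_L2[OF h]]
    by (intro kernel_integral(1)[OF prob_space_axioms fibre_bind]) (simp add: bind_fibre_bind)
  then show ?thesis
    using AE_space
  proof eventually_elim
    case (elim x)
    have sets: "sets (fibre x) = sets Z"
      by (rule kernel_sets[OF prob_space_axioms fibre elim(2)])
    have "p \<in> (fibre x \<bind> G) \<rightarrow>\<^sub>M M"
      using proj measurable_cong_sets[OF kernel_sets[OF prob_space_axioms fibre_bind elim(2)] refl] by blast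
    then have "kernel_op S h x = (\<integral>z. ?h z \<partial>(fibre x \<bind> G))"
      using hM by (simp add: kernel_op_def S[OF elim(2)] integral_distr)
    also have "\<dots> = (\<integral>z. kernel_op G ?h z \<partial>fibre x)"
      unfolding kernel_op_def
      using kernel_prob[OF prob_space_axioms fibre elim(2)] elim(1) kernel_lifted
        measurable_cong_sets[OF sets refl]
      by (intro kernel_integral(3)[where N = Z]) blast+
    also have "\<dots> = (\<integral>y. kernel_op G ?h (e x y) \<partial>\<kappa> x)"
      by (rule integral_fibre[OF elim(2) GhZ])
    finally show ?case .
  qed
qed

lemma inner_op_base:
  assumes f: "f \<in> L2 M" and h: "h \<in> L2 M"
  shows "(\<integral>x. f x * kernel_op S h x \<partial>M)
    = (\<integral>z. f (p z) * kernel_op G (\<lambda>z. h (p z)) z \<partial>total)"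
proof -
  interpret S: invariant_kernel M S by (rule invariant_kernel_base)
  note Gh = G.op_L2(1)[OF lift_L2[OF h]]
  show ?thesis
    unfolding inner_lift[OF f Gh]
    using op_base_AE[OF h] L2_measurable[OF f] L2_measurable[OF S.op_L2(1)[OF h]]
      L2_measurable[OF total_L2(2)[OF Gh]]
    by (intro integral_cong_AE) auto
qed

lemma reversible_kernel_base: "reversible_kernel M S"
proof (intro reversible_kernel.intro reversible_kernel_axioms.intro invariant_kernel_base)
  show "self_adjoint M (kernel_op S)"
    unfolding self_adjoint_def l2_inner_def
  proof (intro ballI)
    fix f g assume "f \<in> L2_0 M" "g \<in> L2_0 M"
    then have fg: "f \<in> L2 M" "g \<in> L2 M" by (simp_all add: L2_0_eq)
    show "(\<integral>x. f x * kernel_op S g x \<partial>M) = (\<integral>x. kernel_op S f x * g x \<partial>M)"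
      using inner_op_base[OF fg] inner_op_base[OF fg(2,1)]
        G.op_symmetric[OF lift_L2[OF fg(1)] lift_L2[OF fg(2)]]
      by (simp add: mult.commute)
  qed
qed

end

end

section \<open>Spectral gap and essential supremum\<close>

context invariant_kernel
begin

lemma Gap_bdd:
  "bdd_below ((\<lambda>f. ((l2_norm M f)\<^sup>2 - l2_inner M f (kernel_op K f)) / (l2_norm M f)\<^sup>2)
    ` {f \<in> L2_0 M. l2_norm M f \<noteq> 0})"
proof (rule bdd_belowI2[where m = 0])
  fix f assume "f \<in> {f \<in> L2_0 M. l2_norm M f \<noteq> 0}"
  then show "0 \<le> ((l2_norm M f)\<^sup>2 - l2_inner M f (kernel_op K f)) / (l2_norm M f)\<^sup>2"
    using inner_op_le[of f] by (simp add: L2_norm_square l2_inner_def L2_0_eq)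
qed

text \<open>Null functions are excluded from the infimum; for them the right side is
  \<open>0\<close> and \<open>inner_op_le\<close> bounds the left side by \<open>0\<close>.\<close>

lemma inner_op_le_Gap:
  assumes f: "f \<in> L2_0 M"
  shows "(\<integral>x. f x * kernel_op K f x \<partial>M) \<le> (1 - Gap M (kernel_op K)) * (\<integral>x. (f x)\<^sup>2 \<partial>M)"
proof (cases "l2_norm M f = 0")
  case True
  then have "(\<integral>x. (f x)\<^sup>2 \<partial>M) = 0"
    using L2_norm_square[of f] by simp
  then show ?thesis
    using inner_op_le[of f] f by (simp add: L2_0_eq)
next
  case False
  then have "Gap M (kernel_op K)
      \<le> ((l2_norm M f)\<^sup>2 - l2_inner M f (kernel_op K f)) / (l2_norm M f)\<^sup>2"
    unfolding Gap_def using f by (intro cINF_lower Gap_bdd) auto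
  moreover have "0 < (l2_norm M f)\<^sup>2"
    using False by simp
  ultimately show ?thesis
    by (simp add: le_divide_eq L2_norm_square l2_inner_def algebra_simps)
qed

lemma Gap_mono:
  assumes ne: "\<exists>f\<in>L2_0 M. l2_norm M f \<noteq> 0"
    and le: "\<And>f. f \<in> L2_0 M \<Longrightarrow>
      (\<integral>x. f x * kernel_op K f x \<partial>M) \<le> (\<integral>x. f x * kernel_op L f x \<partial>M)"
    and L: "invariant_kernel M L"
  shows "Gap M (kernel_op L) \<le> Gap M (kernel_op K)"
  unfolding Gap_def
proof (rule cINF_mono[OF _ invariant_kernel.Gap_bdd[OF L]])
  show "{f \<in> L2_0 M. l2_norm M f \<noteq> 0} \<noteq> {}"
    using ne by auto
  fix f assume f: "f \<in> {f \<in> L2_0 M. l2_norm M f \<noteq> 0}"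
  then have "((l2_norm M f)\<^sup>2 - l2_inner M f (kernel_op L f)) / (l2_norm M f)\<^sup>2
      \<le> ((l2_norm M f)\<^sup>2 - l2_inner M f (kernel_op K f)) / (l2_norm M f)\<^sup>2"
    using le[of f] by (intro divide_right_mono) (simp_all add: l2_inner_def)
  with f show "\<exists>g\<in>{f \<in> L2_0 M. l2_norm M f \<noteq> 0}.
      ((l2_norm M g)\<^sup>2 - l2_inner M g (kernel_op L g)) / (l2_norm M g)\<^sup>2
      \<le> ((l2_norm M f)\<^sup>2 - l2_inner M f (kernel_op K f)) / (l2_norm M f)\<^sup>2"
    by blast
qed

text \<open>A nonnegative form keeps the quotients in \<open>Gap\<close> at most \<open>1\<close>;
  one non-null function is needed to read this off the infimum.\<close>

lemma Gap_le_1: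
  assumes ne: "\<exists>f\<in>L2_0 M. l2_norm M f \<noteq> 0"
    and pos: "\<And>f. f \<in> L2_0 M \<Longrightarrow> 0 \<le> (\<integral>x. f x * kernel_op K f x \<partial>M)"
  shows "Gap M (kernel_op K) \<le> 1"
proof -
  obtain f where f: "f \<in> L2_0 M" "l2_norm M f \<noteq> 0"
    using ne by blast
  then have "0 < (\<integral>x. (f x)\<^sup>2 \<partial>M)"
    using L2_norm_square[of f] by (metis zero_less_power2)
  moreover have "0 \<le> (1 - Gap M (kernel_op K)) * (\<integral>x. (f x)\<^sup>2 \<partial>M)"
    using pos[OF f(1)] inner_op_le_Gap[OF f(1)] by linarith
  ultimately show ?thesis
    by (simp add: zero_le_mult_iff)
qed

end

text \<open>The infimum of the essential upper bounds is itself one: the countably many bounds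
  \<open>ess_sup M g + 1 / real (Suc n)\<close> hold simultaneously off one null set. No
  measurability of \<open>g\<close> is involved.\<close>

lemma (in prob_space)
  assumes pos: "\<And>x. x \<in> space M \<Longrightarrow> 0 \<le> g x" and bound: "AE x in M. g x \<le> c"
  shows ess_sup_AE: "AE x in M. g x \<le> ess_sup M g"
    and ess_sup_le: "ess_sup M g \<le> c"
proof -
  have bdd: "bdd_below {c. AE x in M. g x \<le> c}"
  proof (rule bdd_belowI[where m = 0])
    fix b assume "b \<in> {c. AE x in M. g x \<le> c}"
    then have "AE x in M. g x \<le> b" by simp
    then have "AE x in M. 0 \<le> b"
      using AE_space by eventually_elim (use pos in force)
    \<comment> \<open>A statement without \<open>x\<close> that holds almost everywhere is true,
      since a probability measure is not null.\<close>
    then show "0 \<le> b" by simp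
  qed
  show "ess_sup M g \<le> c"
    unfolding ess_sup_def using bound by (intro cInf_lower bdd) simp
  have "AE x in M. g x \<le> ess_sup M g + 1 / real (Suc n)" for n
  proof -
    have "ess_sup M g < ess_sup M g + 1 / real (Suc n)" by simp
    then obtain b where b: "AE x in M. g x \<le> b" "b < ess_sup M g + 1 / real (Suc n)"
      using cInf_less_iff[OF _ bdd, of "ess_sup M g + 1 / real (Suc n)"] bound
      unfolding ess_sup_def by blast
    from b(1) show ?thesis
      by eventually_elim (use b(2) in linarith)
  qed
  then have "AE x in M. \<forall>n. g x \<le> ess_sup M g + 1 / real (Suc n)"
    by (simp only: AE_all_countable) blast
  then show "AE x in M. g x \<le> ess_sup M g"
  proof eventually_elim
    case (elim x)
    have "(\<lambda>n. ess_sup M g + 1 / real (Suc n)) \<longlonglongrightarrow> ess_sup M g + 0"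
      by (intro tendsto_intros LIMSEQ_Suc lim_1_over_n)
    then show ?case
      using elim by (intro LIMSEQ_le_const) auto
  qed
qed

section \<open>The two-component chain\<close>

text \<open>Bridges the joint measurability hypothesis, given through the real-valued
  \<open>measure\<close>, to \<open>emeasure\<close>; the two agree for probability
  measures.\<close>

lemma measurable_prob_algebra_measure:
  assumes "\<And>x. x \<in> space M \<Longrightarrow> K x \<in> space (prob_algebra N)"
    and "\<And>A. A \<in> sets N \<Longrightarrow> (\<lambda>x. measure (K x) A) \<in> borel_measurable M"
  shows "K \<in> M \<rightarrow>\<^sub>M prob_algebra N"
proof (intro measurable_prob_algebraI measurable_subprob_algebra)
  fix x assume x: "x \<in> space M"
  show "prob_space (K x)" "sets (K x) = sets N"
    using assms(1)[OF x] by (simp_all add: space_prob_algebra)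
  then show "subprob_space (K x)"
    by (intro prob_space_imp_subprob_space)
next
  fix A assume A: "A \<in> sets N"
  have "emeasure (K x) A = ennreal (measure (K x) A)" if "x \<in> space M" for x
  proof -
    interpret prob_space "K x"
      using assms(1)[OF that] by (simp add: space_prob_algebra)
    show ?thesis by (rule emeasure_eq_measure)
  qed
  then show "(\<lambda>x. emeasure (K x) A) \<in> borel_measurable M"
    using assms(2)[OF A] by (simp cong: measurable_cong)
qed

lemma reversible_kernelI:
  assumes \<rho>: "\<rho> \<in> space (prob_algebra N)" and K: "K \<in> N \<rightarrow>\<^sub>M prob_algebra N" and rev: "reversible \<rho> K"
  shows "reversible_kernel \<rho> K"
proof -
  have sets: "sets \<rho> = sets N" and prob: "prob_space \<rho>"
    using \<rho> by (simp_all add: space_prob_algebra)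
  have "K \<in> \<rho> \<rightarrow>\<^sub>M prob_algebra \<rho>"
    using K unfolding measurable_cong_sets[OF sets refl]
    by (simp add: prob_algebra_def subprob_algebra_cong[OF sets])
  then show ?thesis
    using prob rev
    by (simp add: reversible_kernel_def invariant_kernel_def invariant_kernel_axioms_def
        reversible_kernel_axioms_def reversible_def invariant_def)
qed

lemma (in reversible_kernel) reversible: "reversible M K"
  using bind_K self_adjoint_K by (simp add: reversible_def invariant_def)

text \<open>Only \<open>K\<close> is tied to the fibres. \<open>L\<close> is any reversible kernel
  for the total law, and it enters through its two-step kernel compressed to the base, whose gap
  measures how far averaging after \<open>L\<close> contracts.\<close>

lemma (in fibred_kernel) comp_square_le:
  assumes proj: "fibration_proj M N Z \<kappa> e p" and L: "reversible_kernel total L"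
    and LL: "\<And>w. w \<in> space total \<Longrightarrow> LL w = L w \<bind> L"
    and S: "\<And>x. x \<in> space M \<Longrightarrow> S x = distr (fibre x \<bind> LL) M p"
    and c: "AE x in M. (op_norm (\<kappa> x) (kernel_op (H x)))\<^sup>2 \<le> c" "c \<le> 1"
    and Gap: "Gap M (kernel_op S) \<le> 1"
    and f: "f \<in> L2_0 total"
  shows "(\<integral>z. (kernel_op K (kernel_op L f) z)\<^sup>2 \<partial>total)
    \<le> (1 - (1 - c) * Gap M (kernel_op S)) * (\<integral>z. (f z)\<^sup>2 \<partial>total)"
proof -
  interpret fibration_proj M N Z \<kappa> e p by (rule proj)
  interpret L: reversible_kernel total L by (rule L)
  have revLL: "reversible_kernel total LL"
    by (rule L.reversible_kernel_two_step[OF LL])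
  interpret S: reversible_kernel M S
    by (rule reversible_kernel_base[OF revLL S])
  define h where "h = (\<lambda>x. \<integral>y. kernel_op L f (e x y) \<partial>\<kappa> x)"
  have f2: "f \<in> L2 total"
    using f by (simp add: L2_0_eq)
  note g = L.op_L2[OF f2]
  have h: "h \<in> L2 M"
    unfolding h_def by (rule total_L2(2)[OF g(1)])
  \<comment> \<open>\<open>L\<close> and fibre averaging both preserve the integral;
    \<open>Gap\<close> controls mean-zero functions only.\<close>
  have "(\<integral>x. h x \<partial>M) = 0"
    using total_integral(3)[OF total.L2_integrable[OF g(1)]] L.op_integral(3)[OF total.L2_integrable[OF f2]] f
    by (simp add: h_def L2_0_eq)
  with h have h0: "h \<in> L2_0 M"
    by (simp add: L2_0_eq)
  let ?hp = "\<lambda>z. h (p z)" and ?G = "Gap M (kernel_op S)"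
  define a b where "a = (\<integral>x. (h x)\<^sup>2 \<partial>M)" "b = (\<integral>z. (f z)\<^sup>2 \<partial>total)"
  have ab: "0 \<le> a" "0 \<le> b"
    by (simp_all add: a_b_def)
  have "a = (\<integral>x. h x * h x \<partial>M)"
    by (simp add: a_b_def power2_eq_square)
  also have "\<dots> = (\<integral>z. ?hp z * kernel_op L f z \<partial>total)"
    using inner_lift[OF h g(1)] by (simp add: h_def)
  also have "\<dots> = (\<integral>z. kernel_op L ?hp z * f z \<partial>total)"
    by (rule L.op_symmetric[OF lift_L2[OF h] f2])
  finally have "a\<^sup>2 \<le> (\<integral>z. (kernel_op L ?hp z)\<^sup>2 \<partial>total) * b"
    using L2_cauchy_schwarz[OF L.op_L2(1)[OF lift_L2[OF h]] f2] by (simp add: a_b_def)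
  also have "(\<integral>z. (kernel_op L ?hp z)\<^sup>2 \<partial>total) = (\<integral>x. h x * kernel_op S h x \<partial>M)"
    using inner_op_base[OF revLL S h h] L.inner_two_step[OF LL lift_L2[OF h] lift_L2[OF h]]
    by (simp add: power2_eq_square)
  also have "\<dots> * b \<le> ((1 - ?G) * a) * b"
    using S.inner_op_le_Gap[OF h0] ab(2) by (intro mult_right_mono) (simp_all add: a_b_def)
  finally have "a * a \<le> a * ((1 - ?G) * b)"
    by (simp add: power2_eq_square mult_ac)
  \<comment> \<open>A nonzero factor \<open>a\<close> cancels. For \<open>a = 0\<close> the claim is
    that the right side is nonnegative, which is where a gap of at most \<open>1\<close>
    enters.\<close>
  then have a: "a \<le> (1 - ?G) * b"
    using ab Gap by (cases "a = 0") simp_all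
  have "(\<integral>z. (kernel_op K (kernel_op L f) z)\<^sup>2 \<partial>total)
      \<le> (1 - c) * a + c * (\<integral>z. (kernel_op L f z)\<^sup>2 \<partial>total)"
    using total_op_square_le[OF g(1) c(1)] by (simp add: a_b_def h_def)
  also have "\<dots> \<le> (1 - c) * ((1 - ?G) * b) + c * b"
  proof (intro add_mono mult_left_mono a)
    have "AE x in M. 0 \<le> c"
      using c(1) by eventually_elim (rule order_trans[OF zero_le_power2])
    then show "0 \<le> c" by simp
  qed (use c(2) g(2) in \<open>simp_all add: a_b_def\<close>)
  finally show ?thesis
    by (simp add: a_b_def algebra_simps)
qed

theorem proposition7:
  fixes \<phi>1 :: "'a measure" and \<phi>2 :: "'b measure" and \<phi> :: "('a \<times> 'b) measure"
    and \<phi>2c :: "'a \<Rightarrow> 'b measure" and \<phi>1c :: "'b \<Rightarrow> 'a measure"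
    and H1 :: "'b \<Rightarrow> 'a \<Rightarrow> 'a measure" and H2 :: "'a \<Rightarrow> 'b \<Rightarrow> 'b measure"
  assumes "prob_space \<phi>1" and "prob_space \<phi>2"
    and "prob_space \<phi>" and "sets \<phi> = sets (\<phi>1 \<Otimes>\<^sub>M \<phi>2)"
    and "\<phi>2c \<in> \<phi>1 \<rightarrow>\<^sub>M prob_algebra \<phi>2" and "\<phi>1c \<in> \<phi>2 \<rightarrow>\<^sub>M prob_algebra \<phi>1"
    and "\<phi> = \<phi>1 \<bind> (\<lambda>x1. \<phi>2c x1 \<bind> (\<lambda>x2. return (\<phi>1 \<Otimes>\<^sub>M \<phi>2) (x1, x2)))"
    and "\<phi> = \<phi>2 \<bind> (\<lambda>x2. \<phi>1c x2 \<bind> (\<lambda>x1. return (\<phi>1 \<Otimes>\<^sub>M \<phi>2) (x1, x2)))"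
    and "\<And>x2. x2 \<in> space \<phi>2 \<Longrightarrow> H1 x2 \<in> \<phi>1 \<rightarrow>\<^sub>M prob_algebra \<phi>1"
    and "\<And>x1. x1 \<in> space \<phi>1 \<Longrightarrow> H2 x1 \<in> \<phi>2 \<rightarrow>\<^sub>M prob_algebra \<phi>2"
    and "\<And>x2. x2 \<in> space \<phi>2 \<Longrightarrow> reversible (\<phi>1c x2) (H1 x2)"
    and "\<And>x1. x1 \<in> space \<phi>1 \<Longrightarrow> reversible (\<phi>2c x1) (H2 x1)"
    and "\<And>A. A \<in> sets \<phi>1 \<Longrightarrow>
           (\<lambda>(x1, x2). measure (H1 x2 x1) A) \<in> borel_measurable (\<phi>1 \<Otimes>\<^sub>M \<phi>2)"
    and "\<And>A. A \<in> sets \<phi>2 \<Longrightarrow>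
           (\<lambda>(x1, x2). measure (H2 x1 x2) A) \<in> borel_measurable (\<phi>1 \<Otimes>\<^sub>M \<phi>2)"
    and "\<exists>f\<in>L2_0 \<phi>2. l2_norm \<phi>2 f \<noteq> 0"
  shows "invariant \<phi> (T_kernel \<phi>1 \<phi>2 H1 H2)
    \<and> reversible \<phi>2 (S1_hat \<phi>1c H2)
    \<and> reversible \<phi>2 (S2_hat \<phi>1c H2)
    \<and> 1 - (op_norm \<phi> (kernel_op (T_kernel \<phi>1 \<phi>2 H1 H2)))\<^sup>2
        \<ge> (1 - ess_sup \<phi>2 (\<lambda>x2. (op_norm (\<phi>1c x2) (kernel_op (H1 x2)))\<^sup>2))
            * Gap \<phi>2 (kernel_op (S2_hat \<phi>1c H2))
    \<and> ((AE x1 in \<phi>1. pos_semidef (\<phi>2c x1) (kernel_op (H2 x1))) \<longrightarrow>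
        Gap \<phi>2 (kernel_op (S2_hat \<phi>1c H2)) \<ge> Gap \<phi>2 (kernel_op (S1_hat \<phi>1c H2)))"
proof -
  define Z where "Z = \<phi>1 \<Otimes>\<^sub>M \<phi>2"
  define K1 where "K1 = (\<lambda>w. distr (H1 (snd w) (fst w)) Z (\<lambda>x. (x, snd w)))"
  define K2 where "K2 = (\<lambda>w. distr (H2 (fst w) (snd w)) Z (Pair (fst w)))"
  define T where "T = T_kernel \<phi>1 \<phi>2 H1 H2"
  define S1 S2 where "S1 = S1_hat \<phi>1c H2" "S2 = S2_hat \<phi>1c H2"
  note Z = Z_def[symmetric]
  have kernels: "H1 (snd w) (fst w) \<in> space (prob_algebra \<phi>1)" "H2 (fst w) (snd w) \<in> space (prob_algebra \<phi>2)"
    if "w \<in> space Z" for w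
    using that assms(9)[of "snd w", THEN measurable_space, of "fst w"]
      assms(10)[of "fst w", THEN measurable_space, of "snd w"]
    by (auto simp: Z_def space_pair_measure)
  have H1_joint: "(\<lambda>w. H1 (snd w) (fst w)) \<in> Z \<rightarrow>\<^sub>M prob_algebra \<phi>1"
    using kernels(1) assms(13)
    by (intro measurable_prob_algebra_measure) (simp_all add: Z_def case_prod_beta')
  have H2_joint: "(\<lambda>w. H2 (fst w) (snd w)) \<in> Z \<rightarrow>\<^sub>M prob_algebra \<phi>2"
    using kernels(2) assms(14)
    by (intro measurable_prob_algebra_measure) (simp_all add: Z_def case_prod_beta')
  have K1: "K1 \<in> Z \<rightarrow>\<^sub>M prob_algebra Z"
    unfolding K1_def by (rule measurable_distr_prob_space2[OF H1_joint]) (simp add: Z_def)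
  have K2: "K2 \<in> Z \<rightarrow>\<^sub>M prob_algebra Z"
    unfolding K2_def by (rule measurable_distr_prob_space2[OF H2_joint]) (simp add: Z_def)
  have H1_sets: "sets (H1 x2 x1) = sets \<phi>1" "space (H1 x2 x1) \<noteq> {}"
    and H2_sets: "sets (H2 x1 x2) = sets \<phi>2" "space (H2 x1 x2) \<noteq> {}"
    if "x1 \<in> space \<phi>1" "x2 \<in> space \<phi>2" for x1 x2
    using that kernels[of "(x1, x2)"]
    by (auto simp: Z_def space_pair_measure space_prob_algebra prob_space.not_empty)
  have Pair1: "Pair x1 \<in> L \<rightarrow>\<^sub>M Z" if "x1 \<in> space \<phi>1" "sets L = sets \<phi>2" for x1 L
    using measurable_Pair1'[OF that(1), of \<phi>2] measurable_cong_sets[OF that(2) refl] Z_def by blast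
  have Pair2: "(\<lambda>x1. (x1, x2)) \<in> L \<rightarrow>\<^sub>M Z" if "x2 \<in> space \<phi>2" "sets L = sets \<phi>1" for x2 L
    using measurable_Pair2'[OF that(1), of \<phi>1] measurable_cong_sets[OF that(2) refl] Z_def by blast
  \<comment> \<open>The index of \<open>F1\<close> is the coordinate that moves: its base is
    \<phi>2, so the embedding puts the base point second.\<close>
  interpret F1: fibration \<phi>2 \<phi>1 Z \<phi>1c "\<lambda>x2 x1. (x1, x2)"
    using assms(2,6) by (simp add: fibration_def fibration_axioms_def Z_def)
  interpret F2: fibration \<phi>1 \<phi>2 Z \<phi>2c Pair
    using assms(1,5) by (simp add: fibration_def fibration_axioms_def Z_def)
  \<comment> \<open>The two given disintegrations make both fibrations have the same total law; this
    lets \<open>K1\<close> and \<open>K2\<close> act on one space \<open>L2 \<phi>\<close>.\<close>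
  have total1: "F1.total = \<phi>"
    unfolding F1.total_def F1.fibre_def assms(8) Z
    by (intro bind_cong refl bind_return_distr'[symmetric] Pair2 F1.sets_kappa
        prob_space.not_empty F1.prob_kappa)
  have total2: "F2.total = \<phi>"
    unfolding F2.total_def F2.fibre_def assms(7) Z
    by (intro bind_cong refl bind_return_distr'[symmetric] Pair1 F2.sets_kappa
        prob_space.not_empty F2.prob_kappa)
  interpret F1: fibred_kernel \<phi>2 \<phi>1 Z \<phi>1c "\<lambda>x2 x1. (x1, x2)" H1 K1
    using reversible_kernelI[OF measurable_space[OF assms(6)] assms(9,11)] K1
    by (intro fibred_kernel.intro F1.fibration_axioms fibred_kernel_axioms.intro) (simp_all add: K1_def)
  interpret F2: fibred_kernel \<phi>1 \<phi>2 Z \<phi>2c Pair H2 K2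
    using reversible_kernelI[OF measurable_space[OF assms(5)] assms(10,12)] K2
    by (intro fibred_kernel.intro F2.fibration_axioms fibred_kernel_axioms.intro) (simp_all add: K2_def)
  have proj: "fibration_proj \<phi>2 \<phi>1 Z \<phi>1c (\<lambda>x2 x1. (x1, x2)) snd"
    by unfold_locales (simp_all add: Z_def)
  have revK1: "reversible_kernel \<phi> K1" and revK2: "reversible_kernel \<phi> K2"
    using F1.total.reversible_kernel_axioms F2.total.reversible_kernel_axioms total1 total2 by simp_all
  have space: "space \<phi> = space Z"
    using assms(4) Z_def sets_eq_imp_space_eq by blast

  \<comment> \<open>The first move leaves \<open>x2\<close> in place, so \<open>K2\<close> restarts
    from \<open>(x1', x2)\<close> and draws from \<open>H2 x1' x2\<close>. For operators, the kernel
    applied last acts on the function first.\<close>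
  have T: "T w = K1 w \<bind> K2" if w_space: "w \<in> space \<phi>" for w
  proof -
    obtain x1 x2 where w: "w = (x1, x2)" "x1 \<in> space \<phi>1" "x2 \<in> space \<phi>2"
      using w_space by (auto simp: space Z_def space_pair_measure)
    have "K1 w \<bind> K2 = H1 x2 x1 \<bind> (\<lambda>x1'. K2 (x1', x2))"
      unfolding K1_def w fst_conv snd_conv
      by (rule bind_distr[OF Pair2 measurable_prob_algebraD[OF K2]]) (use w H1_sets in auto)
    also have "\<dots> = H1 x2 x1 \<bind> (\<lambda>x1'. H2 x1' x2 \<bind> (\<lambda>x2'. return Z (x1', x2')))"
    proof (intro bind_cong refl)
      fix x1' assume "x1' \<in> space (H1 x2 x1)"
      then have x1': "x1' \<in> space \<phi>1"
        using sets_eq_imp_space_eq[OF H1_sets(1)[OF w(2,3)]] by simp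
      show "K2 (x1', x2) = H2 x1' x2 \<bind> (\<lambda>x2'. return Z (x1', x2'))"
        using x1' w(3) unfolding K2_def fst_conv snd_conv
        by (intro bind_return_distr'[symmetric] Pair1 H2_sets)
    qed
    finally show ?thesis
      by (simp add: T_def T_kernel_def w Z_def)
  qed
  have K1_inv: "invariant_kernel \<phi> K1" and K2_inv: "invariant_kernel \<phi> K2"
    using revK1 revK2 by (simp_all add: reversible_kernel_def)
  interpret K2: reversible_kernel \<phi> K2 by (rule revK2)
  interpret T: invariant_kernel \<phi> T
    by (rule invariant_kernel_comp[OF K1_inv K2_inv T])

  \<comment> \<open>A kernel that moves only the second coordinate is compressed to it: draw
    \<open>x1\<close> given \<open>x2\<close>, move, forget \<open>x1\<close>. A general
    \<open>J\<close> covers both one and two steps of \<open>H2 x1\<close>.\<close>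
  have base: "distr (F1.fibre x2 \<bind> K) \<phi>2 snd = \<phi>1c x2 \<bind> (\<lambda>x1. J x1 x2)"
    if x2: "x2 \<in> space \<phi>2" and K: "K \<in> Z \<rightarrow>\<^sub>M prob_algebra Z"
      and J: "\<And>x1. x1 \<in> space \<phi>1 \<Longrightarrow> K (x1, x2) = distr (J x1 x2) Z (Pair x1)"
        "\<And>x1. x1 \<in> space \<phi>1 \<Longrightarrow> sets (J x1 x2) = sets \<phi>2"
    for x2 K and J :: "'a \<Rightarrow> 'b \<Rightarrow> 'b measure"
  proof -
    have ne: "space (\<phi>1c x2) \<noteq> {}"
      using F1.prob_kappa[OF x2] by (rule prob_space.not_empty)
    have sets: "sets (\<phi>1c x2) = sets \<phi>1"
      by (rule F1.sets_kappa[OF x2])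
    have snd: "snd \<in> Z \<rightarrow>\<^sub>M \<phi>2"
      by (simp add: Z_def)
    have "F1.fibre x2 \<bind> K = \<phi>1c x2 \<bind> (\<lambda>x1. K (x1, x2))"
      unfolding F1.fibre_def by (rule bind_distr[OF Pair2[OF x2 sets] measurable_prob_algebraD[OF K] ne])
    then have "distr (F1.fibre x2 \<bind> K) \<phi>2 snd = \<phi>1c x2 \<bind> (\<lambda>x1. distr (K (x1, x2)) \<phi>2 snd)"
      using distr_bind[OF measurable_compose[OF Pair2[OF x2 sets] measurable_prob_algebraD[OF K]] ne snd]
      by simp
    also have "\<dots> = \<phi>1c x2 \<bind> (\<lambda>x1. J x1 x2)"
    proof (intro bind_cong refl)
      fix x1 assume "x1 \<in> space (\<phi>1c x2)"
      then have x1: "x1 \<in> space \<phi>1"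
        using F1.space_kappa[OF x2] by simp
      show "distr (K (x1, x2)) \<phi>2 snd = J x1 x2"
        unfolding J(1)[OF x1] using distr_distr[OF snd Pair1[OF x1 J(2)[OF x1]]] distr_id2[OF J(2)[OF x1, symmetric]]
        by (simp add: comp_def)
    qed
    finally show ?thesis .
  qed
  have S1: "S1 x2 = distr (F1.fibre x2 \<bind> K2) \<phi>2 snd" if "x2 \<in> space \<phi>2" for x2
    unfolding S1_S2_def S1_hat_def
    using that by (intro base[symmetric] K2) (simp_all add: K2_def H2_sets)

  define K22 where "K22 = (\<lambda>w. K2 w \<bind> K2)"
  have K22: "K22 \<in> Z \<rightarrow>\<^sub>M prob_algebra Z"
    unfolding K22_def by (rule measurable_bind_prob_space[OF K2 K2])
  have two_step: "K22 (x1, x2) = distr (two_step (H2 x1) x2) Z (Pair x1)"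
      "sets (two_step (H2 x1) x2) = sets \<phi>2"
    if x1: "x1 \<in> space \<phi>1" and x2: "x2 \<in> space \<phi>2" for x1 x2
  proof -
    note sets = H2_sets[OF x1 x2]
    have H2x: "H2 x1 \<in> H2 x1 x2 \<rightarrow>\<^sub>M subprob_algebra \<phi>2"
      using measurable_prob_algebraD[OF assms(10)[OF x1]] measurable_cong_sets[OF sets(1) refl] by blast
    have "K22 (x1, x2) = H2 x1 x2 \<bind> (\<lambda>y. K2 (x1, y))"
      unfolding K22_def by (subst (1) K2_def)
        (simp add: bind_distr[OF Pair1[OF x1 sets(1)] measurable_prob_algebraD[OF K2] sets(2)])
    also have "\<dots> = H2 x1 x2 \<bind> (\<lambda>y. distr (H2 x1 y) Z (Pair x1))"
      by (simp add: K2_def)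
    also have "\<dots> = distr (two_step (H2 x1) x2) Z (Pair x1)"
      unfolding two_step_def by (rule distr_bind[symmetric, OF H2x sets(2) Pair1[OF x1 refl]])
    finally show "K22 (x1, x2) = distr (two_step (H2 x1) x2) Z (Pair x1)" .
    show "sets (two_step (H2 x1) x2) = sets \<phi>2"
      unfolding two_step_def using sets_kernel[OF H2x] sets(2) by (rule sets_bind)
  qed
  have S2: "S2 x2 = distr (F1.fibre x2 \<bind> K22) \<phi>2 snd" if "x2 \<in> space \<phi>2" for x2
    unfolding S1_S2_def S2_hat_def
    using that by (intro base[symmetric] K22) (simp_all add: two_step)

  interpret P: fibration_proj \<phi>2 \<phi>1 Z \<phi>1c "\<lambda>x2 x1. (x1, x2)" snd
    by (rule proj)
  have revK22: "reversible_kernel \<phi> K22"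
    by (rule K2.reversible_kernel_two_step) (simp add: K22_def)
  interpret S1: reversible_kernel \<phi>2 S1
    by (rule P.reversible_kernel_base[unfolded total1, OF revK2 S1])
  interpret S2: reversible_kernel \<phi>2 S2
    by (rule P.reversible_kernel_base[unfolded total1, OF revK22 S2])
  have lift: "(\<lambda>z. f (snd z)) \<in> L2 \<phi>" if "f \<in> L2_0 \<phi>2" for f
    using P.lift_L2[of f] that by (simp add: total1 L2_0_eq)
  have inner_S1: "(\<integral>x. f x * kernel_op S1 f x \<partial>\<phi>2)
      = (\<integral>z. f (snd z) * kernel_op K2 (\<lambda>z. f (snd z)) z \<partial>\<phi>)" if "f \<in> L2_0 \<phi>2" for f
    using that by (intro P.inner_op_base[unfolded total1, OF revK2 S1]) (simp_all add: L2_0_eq)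
  have inner_S2: "(\<integral>x. f x * kernel_op S2 f x \<partial>\<phi>2)
      = (\<integral>z. (kernel_op K2 (\<lambda>z. f (snd z)) z)\<^sup>2 \<partial>\<phi>)" if "f \<in> L2_0 \<phi>2" for f
    using that P.inner_op_base[unfolded total1, OF revK22 S2, of f f]
      K2.inner_two_step[of K22, OF _ lift[OF that] lift[OF that]]
    by (simp add: L2_0_eq K22_def power2_eq_square)
  \<comment> \<open>By \<open>inner_S2\<close> the form of \<open>S2\<close> is the integral of a
    square.\<close>
  have Gap_le_1: "Gap \<phi>2 (kernel_op S2) \<le> 1"
    by (rule S2.Gap_le_1[OF assms(15)]) (simp add: inner_S2)

  let ?g = "\<lambda>x2. (op_norm (\<phi>1c x2) (kernel_op (H1 x2)))\<^sup>2"
  define c where "c = ess_sup \<phi>2 ?g"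
  \<comment> \<open>This provides an essential upper bound, so the infimum defining
    \<open>ess_sup\<close> ranges over a nonempty set.\<close>
  have le_1: "AE x2 in \<phi>2. ?g x2 \<le> 1"
    using AE_space
  proof eventually_elim
    case (elim x2)
    then show ?case
      using invariant_kernel.op_norm_bounds[OF F1.invariant_kernel_H[OF elim]] by (simp add: power_le_one)
  qed
  have c: "AE x2 in \<phi>2. ?g x2 \<le> c" "c \<le> 1"
    unfolding c_def by (rule F1.ess_sup_AE[OF _ le_1] F1.ess_sup_le[OF _ le_1]; simp)+
  have "AE x2 in \<phi>2. 0 \<le> c"
    using c(1) by eventually_elim (rule order_trans[OF zero_le_power2])
  then have "0 \<le> c" by simp
  let ?b = "1 - (1 - c) * Gap \<phi>2 (kernel_op S2)"
  have "(1 - c) * Gap \<phi>2 (kernel_op S2) \<le> 1 - c"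
    using c(2) Gap_le_1 by (simp add: mult_left_le)
  with \<open>0 \<le> c\<close> have b: "0 \<le> ?b" by simp
  have "(op_norm \<phi> (kernel_op T))\<^sup>2 \<le> ?b"
  proof (rule T.op_norm_square_le[OF _ b])
    fix f assume f: "f \<in> L2_0 \<phi>"
    then have f2: "f \<in> L2 \<phi>" by (simp add: L2_0_eq)
    have "kernel_op K1 (kernel_op K2 f) \<in> L2 \<phi>"
      by (intro invariant_kernel.op_L2(1)[OF K1_inv] K2.op_L2(1) f2)
    then have "(\<integral>w. (kernel_op T f w)\<^sup>2 \<partial>\<phi>) = (\<integral>w. (kernel_op K1 (kernel_op K2 f) w)\<^sup>2 \<partial>\<phi>)"
      using kernel_op_comp_AE[OF K1_inv K2_inv T f2] T.op_L2(1)[OF f2]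
      by (intro integral_cong_AE) auto
    also have "\<dots> \<le> ?b * (\<integral>w. (f w)\<^sup>2 \<partial>\<phi>)"
      by (rule F1.comp_square_le[unfolded total1, OF proj revK2 _ S2 c Gap_le_1 f]) (simp_all add: K22_def)
    finally show "(\<integral>w. (kernel_op T f w)\<^sup>2 \<partial>\<phi>) \<le> ?b * (\<integral>w. (f w)\<^sup>2 \<partial>\<phi>)" .
  qed
  \<comment> \<open>Here \<open>K2\<close> is viewed through \<open>F2\<close>, whose fibres it
    preserves and where positivity is assumed, although \<open>S1\<close> and \<open>S2\<close> live
    on the base of \<open>F1\<close>.\<close>
  moreover have "Gap \<phi>2 (kernel_op S1) \<le> Gap \<phi>2 (kernel_op S2)"
    if pos: "AE x1 in \<phi>1. pos_semidef (\<phi>2c x1) (kernel_op (H2 x1))"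
  proof (rule S2.Gap_mono[OF assms(15) _ S1.invariant_kernel_axioms])
    fix f assume f: "f \<in> L2_0 \<phi>2"
    show "(\<integral>x. f x * kernel_op S2 f x \<partial>\<phi>2) \<le> (\<integral>x. f x * kernel_op S1 f x \<partial>\<phi>2)"
      unfolding inner_S1[OF f] inner_S2[OF f]
      using F2.total_op_square_le_inner[unfolded total2, OF lift[OF f] pos] .
  qed
  ultimately show ?thesis
    using T.bind_K S1.reversible S2.reversible
    by (simp add: invariant_def T_def S1_S2_def c_def)
qed

end
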